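(* Let $(X,\rho,\mu)$ be a geodesic coarse median space with finite rank and at most exponential volume growth. Then $X$ has subexponential asymptotic dimension growth.
   Context: Coarse median space: $(X,\rho)$ is a metric space and $\mu\colon X^3\to X$ is a ternary operation such that (C1) there are constants $K,H(0)>0$ such that for all $a,b,c,a',b',c'\in X$, $\rho(\mu(a,b,c),\mu(a',b',c'))\leqslant K(\rho(a,a')+\rho(b,b')+\rho(c,c'))+H(0)$; (C2) there is a function $H\colon\mathbb N\to[0,+\infty)$ such that for every finite $A\subseteq X$ with $1\leqslant |A|\leqslant p$ there are a finite median algebra $(\Pi,\mu_\Pi)$ and maps $\pi\colon A\to\Pi$, $\lambda\colon\Pi\to X$ such that for all $x,y,z\in\Pi$, $a\in A$: $\rho(\lambda\mu_\Pi(x,y,z),\mu(\lambda x,\lambda y,\lambda z))\leqslant H(p)$ and $\rho(a,\lambda\pi a)\leqslant H(p)$. A median algebra is a set with a ternary operation $\mu$ that is symmetric in its three arguments and satisfies $\mu(x,x,y)=x$ and $\mu(\mu(x,y,z),u,v)=\mu(\mu(x,u,v),\mu(y,u,v),z)$. The rank of a finite median algebra is the largest $n$ such that the cube $\{0,1\}^n$ (with coordinatewise majority as median) embeds in it as a median subalgebra. $X$ has rank at most $\eta$ if the median algebras $\Pi$ in (C2) can always be chosen of rank at most $\eta$; finite rank means this holds for some $\eta\in\mathbb N$. Geodesic is meant in the discrete sense: $X$ is the vertex set of a connected graph and $\rho$ is the edge-path metric. At most exponential volume growth: there are constants $c,c'\geqslant 1$ such that $\sharp B(x,r)\leqslant c'c^r$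 for all $x\in X$, $r>0$ (in particular $X$ is uniformly locally finite), where $B(x,r)$ is the closed ball. Asymptotic dimension function: for a cover $\mathcal U$ of a metric space, $m(\mathcal U)$ is the maximal number of elements of $\mathcal U$ with non-empty common intersection; $\mathcal U$ is uniformly bounded if $\sup_{U\in\mathcal U}\operatorname{diam}U<\infty$; $\lambda>0$ is a Lebesgue number of $\mathcal U$ if every subset of diameter $\leqslant\lambda$ is contained in some element of $\mathcal U$; $L(\mathcal U)$ is the supremum of all Lebesgue numbers. Put $\mathrm{ad}_X(\lambda)=\min\{m(\mathcal U):\mathcal U \text{ a uniformly bounded cover of }X,\ L(\mathcal U)>\lambda\}-1$. For functions on $\mathbb R_+$ write $f\preceq g$ if there is $k\in\mathbb N$ with $f(x)\leqslant k\,g(kx+k)+k$ for all $x>k$. $X$ has subexponential asymptotic dimension growth if there is a subexponential function $f\colon\mathbb R_+\to\mathbb R_+$ (i.e. for every $c>1$, $f(x)\leqslant c^x$ for all sufficiently large $x$) with $\mathrm{ad}_X\preceq f$. *)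

theory Defs
  imports "HOL-Analysis.Analysis"
begin

section \<open>Median algebras and their rank\<close>

text \<open>The two symmetry axioms are transpositions, which generate all permutations of the
  three arguments.\<close>

locale median_algebra =
  fixes P :: "'p set" and m :: "'p \<Rightarrow> 'p \<Rightarrow> 'p \<Rightarrow> 'p"
  assumes closed: "\<lbrakk>x \<in> P; y \<in> P; z \<in> P\<rbrakk> \<Longrightarrow> m x y z \<in> P"
    and sym12: "\<lbrakk>x \<in> P; y \<in> P; z \<in> P\<rbrakk> \<Longrightarrow> m x y z = m y x z"
    and sym23: "\<lbrakk>x \<in> P; y \<in> P; z \<in> P\<rbrakk> \<Longrightarrow> m x y z = m x z y"
    and majority: "\<lbrakk>x \<in> P; y \<in> P\<rbrakk> \<Longrightarrow> m x x y = x"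
    and distrib: "\<lbrakk>x \<in> P; y \<in> P; z \<in> P; u \<in> P; v \<in> P\<rbrakk>
                  \<Longrightarrow> m (m x y z) u v = m (m x u v) (m y u v) z"

definition cube :: "nat \<Rightarrow> (nat \<Rightarrow> bool) set" where
  "cube n = {..<n} \<rightarrow>\<^sub>E UNIV"

definition cube_median ::
    "nat \<Rightarrow> (nat \<Rightarrow> bool) \<Rightarrow> (nat \<Rightarrow> bool) \<Rightarrow> (nat \<Rightarrow> bool) \<Rightarrow> nat \<Rightarrow> bool" where
  "cube_median n f g h = (\<lambda>i\<in>{..<n}. (f i \<and> g i) \<or> (g i \<and> h i) \<or> (h i \<and> f i))"

definition cube_embeds :: "nat \<Rightarrow> 'p set \<Rightarrow> ('p \<Rightarrow> 'p \<Rightarrow> 'p \<Rightarrow> 'p) \<Rightarrow> bool" where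
  "cube_embeds n P m \<longleftrightarrow>
     (\<exists>\<phi>. \<phi> \<in> cube n \<rightarrow> P \<and> inj_on \<phi> (cube n) \<and>
          (\<forall>f\<in>cube n. \<forall>g\<in>cube n. \<forall>h\<in>cube n.
             \<phi> (cube_median n f g h) = m (\<phi> f) (\<phi> g) (\<phi> h)))"

text \<open>Only meaningful for finite nonempty \<open>P\<close>: then the set below contains \<open>0\<close> and is finite,
  since an embedded \<open>n\<close>-cube forces \<open>2 ^ n \<le> card P\<close>.\<close>

definition median_rank :: "'p set \<Rightarrow> ('p \<Rightarrow> 'p \<Rightarrow> 'p \<Rightarrow> 'p) \<Rightarrow> nat" where
  "median_rank P m = Max {n. cube_embeds n P m}"


section \<open>Coarse median spaces\<close>

text \<open>The maps \<open>\<pi> : A \<rightarrow> P\<close> and \<open>l : P \<rightarrow> X\<close> of condition (C2), with error at most \<open>h\<close>.\<close>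

definition approximates ::
    "'a set \<Rightarrow> ('a \<Rightarrow> 'a \<Rightarrow> real) \<Rightarrow> ('a \<Rightarrow> 'a \<Rightarrow> 'a \<Rightarrow> 'a) \<Rightarrow> real \<Rightarrow> 'a set
      \<Rightarrow> 'p set \<Rightarrow> ('p \<Rightarrow> 'p \<Rightarrow> 'p \<Rightarrow> 'p) \<Rightarrow> bool" where
  "approximates X \<rho> \<mu> h A P m \<longleftrightarrow>
     (\<exists>\<pi> l. \<pi> \<in> A \<rightarrow> P \<and> l \<in> P \<rightarrow> X \<and>
        (\<forall>x\<in>P. \<forall>y\<in>P. \<forall>z\<in>P. \<rho> (l (m x y z)) (\<mu> (l x) (l y) (l z)) \<le> h) \<and>
        (\<forall>a\<in>A. \<rho> a (l (\<pi> a)) \<le> h))"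

text \<open>Every finite median algebra is isomorphic to one carried by a set of natural numbers, so
  quantifying over \<open>P :: nat set\<close> loses no generality in (C2).\<close>

locale coarse_median_space = Metric_space X \<rho>
  for X :: "'a set" and \<rho> :: "'a \<Rightarrow> 'a \<Rightarrow> real" +
  fixes \<mu> :: "'a \<Rightarrow> 'a \<Rightarrow> 'a \<Rightarrow> 'a"
  assumes \<mu>_closed: "\<lbrakk>a \<in> X; b \<in> X; c \<in> X\<rbrakk> \<Longrightarrow> \<mu> a b c \<in> X"
    and C1: "\<exists>K>0. \<exists>H0>0. \<forall>a\<in>X. \<forall>b\<in>X. \<forall>c\<in>X. \<forall>a'\<in>X. \<forall>b'\<in>X. \<forall>c'\<in>X.
               \<rho> (\<mu> a b c) (\<mu> a' b' c') \<le> K * (\<rho> a a' + \<rho> b b' + \<rho> c c') + H0"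
    and C2: "\<exists>H :: nat \<Rightarrow> real. (\<forall>p. 0 \<le> H p) \<and>
               (\<forall>p A. A \<subseteq> X \<and> finite A \<and> 1 \<le> card A \<and> card A \<le> p \<longrightarrow>
                  (\<exists>(P :: nat set) m. finite P \<and> median_algebra P m \<and>
                     approximates X \<rho> \<mu> (H p) A P m))"

definition rank_at_most ::
    "'a set \<Rightarrow> ('a \<Rightarrow> 'a \<Rightarrow> real) \<Rightarrow> ('a \<Rightarrow> 'a \<Rightarrow> 'a \<Rightarrow> 'a) \<Rightarrow> nat \<Rightarrow> bool" where
  "rank_at_most X \<rho> \<mu> \<eta> \<longleftrightarrow>
     (\<exists>H :: nat \<Rightarrow> real. (\<forall>p. 0 \<le> H p) \<and>
        (\<forall>p A. A \<subseteq> X \<and> finite A \<and> 1 \<le> card A \<and> card A \<le> p \<longrightarrow>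
           (\<exists>(P :: nat set) m. finite P \<and> median_algebra P m \<and> median_rank P m \<le> \<eta> \<and>
              approximates X \<rho> \<mu> (H p) A P m)))"

definition finite_rank ::
    "'a set \<Rightarrow> ('a \<Rightarrow> 'a \<Rightarrow> real) \<Rightarrow> ('a \<Rightarrow> 'a \<Rightarrow> 'a \<Rightarrow> 'a) \<Rightarrow> bool" where
  "finite_rank X \<rho> \<mu> \<longleftrightarrow> (\<exists>\<eta>. rank_at_most X \<rho> \<mu> \<eta>)"


section \<open>Discretely geodesic spaces and volume growth\<close>

text \<open>\<open>(x, y) \<in> E ^^ n\<close> says that there is an edge path of length \<open>n\<close> from \<open>x\<close> to \<open>y\<close>.\<close>

definition discretely_geodesic :: "'a set \<Rightarrow> ('a \<Rightarrow> 'a \<Rightarrow> real) \<Rightarrow> bool" where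
  "discretely_geodesic X \<rho> \<longleftrightarrow>
     (\<exists>E. E \<subseteq> X \<times> X \<and> sym E \<and> irrefl E \<and>
          (\<forall>x\<in>X. \<forall>y\<in>X. (x, y) \<in> E\<^sup>*) \<and>
          (\<forall>x\<in>X. \<forall>y\<in>X. \<rho> x y = real (LEAST n. (x, y) \<in> E ^^ n)))"

definition at_most_exponential_growth :: "'a set \<Rightarrow> ('a \<Rightarrow> 'a \<Rightarrow> real) \<Rightarrow> bool" where
  "at_most_exponential_growth X \<rho> \<longleftrightarrow>
     (\<exists>c\<ge>1. \<exists>c'\<ge>1. \<forall>x\<in>X. \<forall>r>0.
        finite (Metric_space.mcball X \<rho> x r) \<and>
        real (card (Metric_space.mcball X \<rho> x r)) \<le> c' * c powr r)"


section \<open>Asymptotic dimension growth\<close>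

text \<open>The diameter is taken in the extended nonnegative reals (HOL-Analysis' \<open>diameter\<close> is
  real-valued and hence meaningless on unbounded sets); the empty set has diameter \<open>0\<close>.\<close>

definition ediam :: "('a \<Rightarrow> 'a \<Rightarrow> real) \<Rightarrow> 'a set \<Rightarrow> ennreal" where
  "ediam \<rho> S = (SUP x\<in>S. SUP y\<in>S. ennreal (\<rho> x y))"

definition uniformly_bounded :: "('a \<Rightarrow> 'a \<Rightarrow> real) \<Rightarrow> 'a set set \<Rightarrow> bool" where
  "uniformly_bounded \<rho> \<U> \<longleftrightarrow> (SUP U\<in>\<U>. ediam \<rho> U) < \<infinity>"

text \<open>The multiplicity \<open>m(\<U>)\<close>. Infinite subfamilies with a common point are accounted for by
  their finite subfamilies, which make the supremum \<open>\<infinity>\<close>.\<close>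

definition multiplicity_cover :: "'a set set \<Rightarrow> enat" where
  "multiplicity_cover \<U> = Sup {enat (card F) | F. F \<subseteq> \<U> \<and> finite F \<and> F \<noteq> {} \<and> \<Inter>F \<noteq> {}}"

definition lebesgue_number :: "'a set \<Rightarrow> ('a \<Rightarrow> 'a \<Rightarrow> real) \<Rightarrow> 'a set set \<Rightarrow> real \<Rightarrow> bool" where
  "lebesgue_number X \<rho> \<U> r \<longleftrightarrow>
     r > 0 \<and> (\<forall>S\<subseteq>X. ediam \<rho> S \<le> ennreal r \<longrightarrow> (\<exists>U\<in>\<U>. S \<subseteq> U))"

definition sup_lebesgue_number :: "'a set \<Rightarrow> ('a \<Rightarrow> 'a \<Rightarrow> real) \<Rightarrow> 'a set set \<Rightarrow> ereal" where
  "sup_lebesgue_number X \<rho> \<U> = (SUP r\<in>{r. lebesgue_number X \<rho> \<U> r}. ereal r)"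

text \<open>The infimum is a minimum whenever some cover is admissible, and \<open>\<infinity>\<close> otherwise.
  The passage to \<open>ereal\<close> makes the subtraction of \<open>1\<close> non-truncated.\<close>

definition asdim_fun :: "'a set \<Rightarrow> ('a \<Rightarrow> 'a \<Rightarrow> real) \<Rightarrow> real \<Rightarrow> ereal" where
  "asdim_fun X \<rho> r =
     ereal_of_enat (INF \<U>\<in>{\<U>. \<Union>\<U> = X \<and> uniformly_bounded \<rho> \<U> \<and>
                              sup_lebesgue_number X \<rho> \<U> > ereal r}. multiplicity_cover \<U>) - 1"

text \<open>Functions on \<open>\<real>\<^sub>+\<close> are represented by functions on \<open>real\<close>; only their values at nonnegative
  arguments matter.\<close>

definition growth_le :: "(real \<Rightarrow> ereal) \<Rightarrow> (real \<Rightarrow> ereal) \<Rightarrow> bool" (infix \<open>\<preceq>\<^sub>g\<close> 50) where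
  "f \<preceq>\<^sub>g g \<longleftrightarrow>
     (\<exists>k::nat. \<forall>x > real k.
        f x \<le> ereal (real k) * g (real k * x + real k) + ereal (real k))"

definition subexponential :: "(real \<Rightarrow> real) \<Rightarrow> bool" where
  "subexponential f \<longleftrightarrow> (\<forall>c>1. \<forall>\<^sub>F x in at_top. f x \<le> c powr x)"

definition subexponential_asdim_growth :: "'a set \<Rightarrow> ('a \<Rightarrow> 'a \<Rightarrow> real) \<Rightarrow> bool" where
  "subexponential_asdim_growth X \<rho> \<longleftrightarrow>
     (\<exists>f :: real \<Rightarrow> real. (\<forall>x\<ge>0. f x \<ge> 0) \<and> subexponential f \<and>
        asdim_fun X \<rho> \<preceq>\<^sub>g (\<lambda>x. ereal (f x)))"

end

theory Submission
  imports Defs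
begin

text \<open>
  It suffices to find, for every \<open>\<epsilon> > 0\<close> and all large \<open>r\<close>, a map \<open>h : X \<rightarrow> X\<close> of bounded
  displacement that sends every \<open>r\<close>-ball into a union of at most \<open>N(\<epsilon>)\<close> balls of radius \<open>\<epsilon> r\<close>: the
  \<open>r\<close>-neighbourhoods of the fibres of \<open>h\<close> then have Lebesgue number \<open>r\<close>, and by the growth hypothesis
  their multiplicity is at most \<open>N(\<epsilon>)\<close> times an exponential of rate proportional to \<open>\<epsilon>\<close>.

  With a base point \<open>c\<close>, let \<open>h y\<close> be a coarse join of \<open>[y, c] \<inter> B(y, O(r))\<close>, ordered from \<open>y\<close>
  towards \<open>c\<close>. For \<open>y\<close> near \<open>x\<close> these joins lie near \<open>[x, c] \<inter> B(x, O(r))\<close>, so everything reduces to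
  bounding \<open>\<epsilon> r\<close>-separated sets in \<open>[a, b] \<inter> B(a, r)\<close>. In a finite median algebra of rank at most
  \<open>\<eta>\<close> the interval \<open>[a, b]\<close> is a distributive lattice whose poset of join primes has width at most
  \<open>\<eta>\<close>. Hence any join is a join of at most \<open>\<eta>\<close> of its members and stays at bounded distance from \<open>a\<close>,
  and a discretized geodesic from \<open>a\<close> to such a join \<open>h\<close> yields a monotone path whose \<open>n\<close> steps cut the
  join primes into layers. With Dilworth's \<open>\<eta>\<close> chains this gives at most \<open>(n + 1) ^ \<eta>\<close> classes of
  elements of \<open>[a, h]\<close>, each of small diameter.
\<close>

section \<open>Dilworth's theorem\<close>

text \<open>Induction on the size of \<open>A\<close>: split off a maximal element \<open>a\<close>,
  colour the rest with \<open>k\<close> colours, and use the colour classes to find a chain through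
  \<open>a\<close> whose removal lowers the bound on antichains to \<open>k - 1\<close>.\<close>

lemma dilworth:
  fixes A :: "'a::order set"
  assumes "finite A" and "\<And>Q. \<lbrakk>Q \<subseteq> A; \<And>x y. \<lbrakk>x \<in> Q; y \<in> Q; x \<le> y\<rbrakk> \<Longrightarrow> x = y\<rbrakk> \<Longrightarrow> card Q \<le> k"
  obtains col :: "'a \<Rightarrow> nat" where "\<And>x. x \<in> A \<Longrightarrow> col x < k"
    and "\<And>x y. \<lbrakk>x \<in> A; y \<in> A; col x = col y\<rbrakk> \<Longrightarrow> x \<le> y \<or> y \<le> x"
proof -
  define anti where "anti Q \<longleftrightarrow> (\<forall>x\<in>Q. \<forall>y\<in>Q. x \<le> y \<longrightarrow> x = y)" for Q :: "'a set"
  have "\<exists>col :: 'a \<Rightarrow> nat. (\<forall>x\<in>A. col x < k) \<and>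
      (\<forall>x\<in>A. \<forall>y\<in>A. col x = col y \<longrightarrow> x \<le> y \<or> y \<le> x)"
    if "finite A" "\<And>Q. \<lbrakk>Q \<subseteq> A; anti Q\<rbrakk> \<Longrightarrow> card Q \<le> k" for A k
    using that
  proof (induction "card A" arbitrary: A k rule: less_induct)
    case less
    show ?case
    proof (cases "A = {}")
      case False
      then obtain a where a: "a \<in> A" "\<And>x. \<lbrakk>x \<in> A; a \<le> x\<rbrakk> \<Longrightarrow> x = a"
        using finite_has_maximal[OF less.prems(1)] by metis
      have fin': "finite (A - {a})" and card': "card (A - {a}) < card A"
        using less.prems(1) card_Diff1_less[OF less.prems(1) a(1)] by auto
      have k: "k > 0"
        using less.prems(2)[of "{a}"] a(1) by (auto simp: anti_def)
      have w': "card Q \<le> k" if "Q \<subseteq> A - {a}" "anti Q" for Q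
        using less.prems(2) that by blast
      obtain col :: "'a \<Rightarrow> nat" where col: "\<And>x. x \<in> A - {a} \<Longrightarrow> col x < k"
        and col': "\<And>x y. \<lbrakk>x \<in> A - {a}; y \<in> A - {a}; col x = col y\<rbrakk> \<Longrightarrow> x \<le> y \<or> y \<le> x"
        using less.hyps[OF card' fin' w'] by blast
      \<comment> \<open>\<open>k\<close> is only an upper bound, so there may be no
        \<open>big\<close> set; then the chain \<open>{a}\<close> already works.\<close>
      define big where "big Q \<longleftrightarrow> Q \<subseteq> A - {a} \<and> anti Q \<and> card Q = k" for Q
      have onto: "\<exists>x\<in>Q. col x = t" if "big Q" "t < k" for Q t
      proof -
        have "inj_on col Q"
        proof (rule inj_onI)
          fix x y assume "x \<in> Q" "y \<in> Q" "col x = col y"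
          moreover from this have "x \<le> y \<or> y \<le> x"
            using that(1) col'[of x y] by (auto simp: big_def)
          ultimately show "x = y" using that(1) by (auto simp: big_def anti_def)
        qed
        then have "card (col ` Q) = card {..<k}"
          using that(1) by (simp add: card_image big_def)
        moreover have "col ` Q \<subseteq> {..<k}"
          using that(1) col by (auto simp: big_def)
        ultimately have "col ` Q = {..<k}"
          by (simp add: card_subset_eq)
        then have "t \<in> col ` Q" using that(2) by simp
        then show ?thesis by blast
      qed
      txt \<open>Galvin's argument: remove a chain through \<open>a\<close> that meets all maximum antichains.\<close>
      have "\<exists>K. a \<in> K \<and> K \<subseteq> A \<and> (\<forall>x\<in>K. \<forall>y\<in>K. x \<le> y \<or> y \<le> x) \<and>
               (\<forall>Q. big Q \<longrightarrow> Q \<inter> K \<noteq> {})"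
      proof (cases "\<exists>Q. big Q")
        case False
        then show ?thesis using a(1) by (intro exI[of _ "{a}"]) auto
      next
        case True
        \<comment> \<open>Every \<open>big\<close> antichain meets each colour exactly once; the
          largest elements \<open>top t\<close> of the sets \<open>C t\<close> turn out to be
          pairwise incomparable.\<close>
        define C where "C t = {x \<in> A - {a}. col x = t \<and> (\<exists>Q. big Q \<and> x \<in> Q)}" for t
        have "\<exists>x\<in>C t. \<forall>y\<in>C t. y \<le> x" if "t < k" for t
        proof -
          have "finite (C t)" using fin' by (simp add: C_def)
          moreover obtain Q x where "big Q" "x \<in> Q" "col x = t"
            using True onto \<open>t < k\<close> by blast
          then have "C t \<noteq> {}" unfolding C_def by (auto simp: big_def)
          ultimately obtain x where x: "x \<in> C t" "\<And>y. \<lbrakk>y \<in> C t; x \<le> y\<rbrakk> \<Longrightarrow> x = y"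
            using finite_has_maximal by metis
          have "y \<le> x" if "y \<in> C t" for y
            using x that col'[of x y] by (auto simp: C_def)
          with x(1) show ?thesis by blast
        qed
        then obtain top where top: "\<And>t. t < k \<Longrightarrow> top t \<in> C t"
            "\<And>t y. \<lbrakk>t < k; y \<in> C t\<rbrakk> \<Longrightarrow> y \<le> top t"
          by metis
        have anti_top: "s = t" if st: "s < k" "t < k" "top s \<le> top t" for s t
        proof -
          obtain Q where Q: "big Q" "top t \<in> Q" using top(1)[OF st(2)] by (auto simp: C_def)
          obtain y where y: "y \<in> Q" "col y = s" using onto[OF Q(1) st(1)] by blast
          then have "y \<in> C s" using Q(1) by (auto simp: C_def big_def)
          then have "y \<le> top t" using top(2)[OF st(1)] st(3) by force
          then have "y = top t" using Q y(1) by (auto simp: big_def anti_def)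
          then show ?thesis using y(2) top(1)[OF st(2)] by (auto simp: C_def)
        qed
        have inj: "inj_on top {..<k}"
          using anti_top by (auto intro: inj_onI)
        \<comment> \<open>Otherwise there would be an antichain with \<open>k + 1\<close> elements.
          Since \<open>a\<close> is maximal, some \<open>top t\<close> must lie below
          \<open>a\<close>, and \<open>a\<close> extends the part of colour \<open>t\<close> below
          \<open>top t\<close> to a chain.\<close>
        have "\<not> anti (insert a (top ` {..<k}))"
        proof
          assume "anti (insert a (top ` {..<k}))"
          moreover have sub: "top ` {..<k} \<subseteq> A - {a}"
            using top(1) by (auto simp: C_def)
          ultimately have "card (insert a (top ` {..<k})) \<le> k"
            using a(1) by (intro less.prems(2)) auto
          moreover have "a \<notin> top ` {..<k}" using sub by blast
          ultimately show False using inj by (simp add: card_image)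
        qed
        then obtain t where t: "t < k" "top t \<le> a"
          using anti_top a(2) top(1) unfolding anti_def C_def by (smt (verit, ccfv_threshold) DiffD1 image_iff insert_iff lessThan_iff mem_Collect_eq order_refl)
        define K where "K = insert a {z \<in> A - {a}. col z = t \<and> z \<le> top t}"
        have "x \<le> y \<or> y \<le> x" if "x \<in> K" "y \<in> K" for x y
          using that t(2) col'[of x y] unfolding K_def by (auto intro: order_trans)
        moreover have "Q \<inter> K \<noteq> {}" if "big Q" for Q
        proof -
          obtain y where y: "y \<in> Q" "col y = t" using onto[OF \<open>big Q\<close> t(1)] by blast
          then have "y \<in> C t" using that by (auto simp: C_def big_def)
          then have "y \<in> K" using top(2)[OF t(1)] by (auto simp: K_def C_def)
          then show ?thesis using y(1) by blast
        qed
        ultimately show ?thesis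
          using a(1) by (intro exI[of _ K]) (auto simp: K_def)
      qed
      then obtain K where K: "a \<in> K" "K \<subseteq> A" "\<And>x y. \<lbrakk>x \<in> K; y \<in> K\<rbrakk> \<Longrightarrow> x \<le> y \<or> y \<le> x"
        "\<And>Q. big Q \<Longrightarrow> Q \<inter> K \<noteq> {}"
        by blast
      have "card Q \<le> k - 1" if Q: "Q \<subseteq> A - K" "anti Q" for Q
      proof -
        have "card Q \<le> k" using less.prems(2) Q by blast
        moreover have "card Q \<noteq> k"
          using K(1) K(4)[of Q] Q by (auto simp: big_def)
        ultimately show ?thesis by simp
      qed
      moreover have "card (A - K) < card A"
        using K(1,2) less.prems(1) by (intro psubset_card_mono) auto
      ultimately obtain col' :: "'a \<Rightarrow> nat" where
        c1: "\<forall>x\<in>A - K. col' x < k - 1"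
        and c2: "\<forall>x\<in>A - K. \<forall>y\<in>A - K. col' x = col' y \<longrightarrow> x \<le> y \<or> y \<le> x"
        using less.hyps[of "A - K" "k - 1"] less.prems(1) by auto
      show ?thesis
      proof (intro exI[of _ "\<lambda>x. if x \<in> K then k - 1 else col' x"] conjI ballI impI)
        fix x assume "x \<in> A"
        then show "(if x \<in> K then k - 1 else col' x) < k"
          using c1[rule_format, of x] k by (cases "x \<in> K") auto
      next
        fix x y assume "x \<in> A" "y \<in> A"
          "(if x \<in> K then k - 1 else col' x) = (if y \<in> K then k - 1 else col' y)"
        then show "x \<le> y \<or> y \<le> x"
          using c1[rule_format, of x] c1[rule_format, of y] c2[rule_format, of x y] K(3)[of x y]
          by (cases "x \<in> K"; cases "y \<in> K") auto
      qed
    qed auto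
  qed
  from this[OF assms(1), of k] assms(2) that show thesis
    unfolding anti_def by metis
qed

section \<open>Intervals in finite median algebras\<close>

context median_algebra
begin

lemma perm:
  assumes "x \<in> P" "y \<in> P" "z \<in> P"
  shows "m x z y = m x y z" "m y x z = m x y z" "m y z x = m x y z" "m z x y = m x y z" "m z y x = m x y z"
proof -
  show 1: "m x z y = m x y z" using sym23 assms by simp
  show 2: "m y x z = m x y z" using sym12 assms by simp
  show 3: "m y z x = m x y z" using sym23[of y z x] assms 2 by simp
  show 4: "m z x y = m x y z" using sym12[of z x y] assms 1 by simp
  show 5: "m z y x = m x y z" using sym23[of z y x] assms 4 by simp
qed

lemma majority':
  assumes "x \<in> P" "y \<in> P"
  shows "m x x y = x" "m x y x = x" "m y x x = x"
  using assms majority[of x y] sym12[of x y x] sym23[of x x y] by simp_all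

end

section \<open>Cubes and the rank\<close>

lemma card_cube: "finite (cube n) \<and> card (cube n) = 2 ^ n"
  by (simp add: cube_def finite_PiE card_PiE)

text \<open>An embedded \<open>k\<close>-cube has \<open>2 ^ k\<close> points in \<open>P\<close>,
  so the set whose \<open>Max\<close> defines the rank is finite.\<close>

lemma cube_embeds_le_rank:
  assumes "finite P" "cube_embeds n P m"
  shows "n \<le> median_rank P m"
proof -
  have "{n. cube_embeds n P m} \<subseteq> {..card P}"
  proof
    fix k assume "k \<in> {n. cube_embeds n P m}"
    then obtain \<phi> where "\<phi> ` cube k \<subseteq> P" "inj_on \<phi> (cube k)"
      unfolding cube_embeds_def by fast
    then have "card (cube k) \<le> card P"
      using assms(1) by (metis card_inj_on_le)
    then have "2 ^ k \<le> card P" by (simp add: card_cube)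
    then show "k \<in> {..card P}"
      using less_exp[of k] by (metis atMost_iff le_trans less_imp_le)
  qed
  then have "finite {n. cube_embeds n P m}"
    by (rule finite_subset) simp
  then show ?thesis
    unfolding median_rank_def using assms(2) by (intro Max_ge) auto
qed

section \<open>The interval as a distributive lattice\<close>

locale median_interval = median_algebra P m for P :: "'p set" and m +
  fixes a b :: 'p
  assumes finite_P: "finite P" and a_in: "a \<in> P" and b_in: "b \<in> P"
begin

definition I :: "'p set" where
  "I = {x \<in> P. m a b x = x}"

text \<open>The lattice order with bottom \<open>a\<close> and top \<open>b\<close>: meets are
  \<open>m a x y\<close> and joins are \<open>m b x y\<close>.\<close>

definition leq :: "'p \<Rightarrow> 'p \<Rightarrow> bool" where
  "leq x y \<longleftrightarrow> m a x y = x"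

text \<open>Join primes. The bottom \<open>a\<close> lies below everything and satisfies the
  primeness clause trivially, hence its exclusion.\<close>

definition J :: "'p set" where
  "J = {j \<in> I. j \<noteq> a \<and> (\<forall>u\<in>I. \<forall>v\<in>I. leq j (m b u v) \<longrightarrow> leq j u \<or> leq j v)}"

text \<open>Birkhoff's representation: encoding an element by the join primes below it turns lattice
  arguments into set algebra.\<close>

definition D :: "'p \<Rightarrow> 'p set" where
  "D x = {j \<in> J. leq j x}"

lemma I_P: "x \<in> I \<Longrightarrow> x \<in> P"
  by (simp add: I_def)

lemma finite_I: "finite I"
  using finite_P by (simp add: I_def)

lemma a_I: "a \<in> I" and b_I: "b \<in> I"
  using a_in b_in majority'[OF a_in b_in] majority'[OF b_in a_in] by (auto simp: I_def)

lemma I_abs: "x \<in> I \<Longrightarrow> m a b x = x" "x \<in> I \<Longrightarrow> m b a x = x"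
  using a_in b_in by (auto simp: I_def perm)

text \<open>Convexity of the interval: distributivity lets the projection act on \<open>x\<close>
  and \<open>y\<close> only, so \<open>z\<close> may be any point of \<open>P\<close>.\<close>

lemma m_I: 
  assumes "x \<in> I" "y \<in> I" "z \<in> P"
  shows "m x y z \<in> I"
proof -
  have xyz: "m x y z \<in> P"
    using assms I_P closed by blast
  have "m (m x y z) a b = m (m x a b) (m y a b) z"
    using assms I_P a_in b_in by (intro distrib) auto
  also have "\<dots> = m x y z"
    using assms I_abs I_P a_in b_in perm(4)[of a b x] perm(4)[of a b y] by simp
  finally show ?thesis
    unfolding I_def using perm(4)[OF a_in b_in xyz] xyz by auto
qed

lemma project_I: "x \<in> P \<Longrightarrow> m a b x \<in> I"
  using m_I a_I b_I by simp

lemma leq_refl: "x \<in> I \<Longrightarrow> leq x x"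
  unfolding leq_def using a_in I_P by (simp add: majority')

lemma leq_antisym: "\<lbrakk>x \<in> I; y \<in> I; leq x y; leq y x\<rbrakk> \<Longrightarrow> x = y"
  unfolding leq_def using a_in I_P by (metis perm(1))

lemma meet_assoc:
  assumes "x \<in> P" "y \<in> P" "z \<in> P"
  shows "m a x (m a y z) = m a (m a x y) z"
proof -
  have "m (m a y z) a x = m (m a a x) (m y a x) z"
    using assms a_in by (intro distrib) auto
  then show ?thesis
    using assms a_in closed by (simp add: perm majority')
qed

lemma leq_trans: "\<lbrakk>x \<in> I; y \<in> I; z \<in> I; leq x y; leq y z\<rbrakk> \<Longrightarrow> leq x z"
  unfolding leq_def using meet_assoc[of x y z] I_P by metis

lemma meet_leq:
  assumes "x \<in> I" "y \<in> I"
  shows "leq (m a x y) x" "leq (m a x y) y"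
  using assms meet_assoc[of x x y] meet_assoc[of y x y] meet_assoc[of y y x] a_in I_P closed
  unfolding leq_def by (auto simp: perm majority')

lemma leq_join:
  assumes "x \<in> I" "y \<in> I"
  shows "leq x (m b x y)" "leq y (m b x y)"
proof -
  have *: "leq x (m b y x)" if "x \<in> I" "y \<in> I" for x y
  proof -
    have "m (m b y x) a x = m (m b a x) (m y a x) x"
      using that a_in b_in I_P by (intro distrib) auto
    also have "\<dots> = x"
      using that I_abs a_in b_in I_P closed by (simp add: majority')
    finally show ?thesis
      unfolding leq_def using that a_in b_in I_P closed by (simp add: perm)
  qed
  show "leq x (m b x y)" "leq y (m b x y)"
    using * assms I_P b_in by (metis perm(1))+
qed

lemma meet_join_distrib:
  assumes "x \<in> I" "y \<in> I" "z \<in> I"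
  shows "m a x (m b y z) = m b (m a x y) (m a x z)"
proof -
  have "m (m y z b) a x = m (m y a x) (m z a x) b"
    using assms a_in b_in I_P by (intro distrib) auto
  then show ?thesis
    using assms a_in b_in I_P closed by (simp add: perm)
qed

lemma leq_iff_join:
  assumes "x \<in> I" "y \<in> I"
  shows "leq x y \<longleftrightarrow> m b x y = y"
proof
  assume "leq x y"
  then have "m a x y = x" by (simp add: leq_def)
  have "m (m a x y) b y = m (m a b y) (m x b y) y"
    using assms a_in b_in I_P by (intro distrib) auto
  also have "\<dots> = y"
    using assms I_abs a_in b_in I_P closed by (simp add: majority')
  finally show "m b x y = y"
    using \<open>m a x y = x\<close> assms a_in b_in I_P closed by (simp add: perm)
next
  assume "m b x y = y"
  then show "leq x y" using leq_join(1)[OF assms] by simp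
qed

lemma join_least:
  assumes "x \<in> I" "y \<in> I" "z \<in> I" "leq x z" "leq y z"
  shows "leq (m b x y) z"
proof -
  have "m a z (m b x y) = m b (m a z x) (m a z y)"
    by (rule meet_join_distrib) (use assms in auto)
  also have "\<dots> = m b x y"
    using assms a_in I_P unfolding leq_def by (simp add: perm)
  finally show ?thesis
    unfolding leq_def using assms a_in b_in I_P closed by (simp add: perm)
qed

section \<open>Join primes and Birkhoff's representation\<close>

lemma D_sub: "D x \<subseteq> J" and J_I: "J \<subseteq> I" and finite_J: "finite J"
  using finite_I by (auto simp: D_def J_def)

text \<open>A minimal \<open>j\<close> among the elements below \<open>x\<close> but not below
  \<open>y\<close> is join prime: if \<open>j\<close> is below the join of \<open>u\<close> and
  \<open>v\<close> but below neither, its meets with \<open>u\<close> and \<open>v\<close> are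
  strictly smaller, hence below \<open>y\<close>, and so is their join \<open>j\<close>.\<close>

lemma D_separates:
  assumes "x \<in> I" "y \<in> I" "\<not> leq x y"
  shows "\<exists>j\<in>D x. j \<notin> D y"
proof -
  define S where "S = {j \<in> I. leq j x \<and> \<not> leq j y}"
  have "finite S" "S \<noteq> {}" using finite_I assms leq_refl by (auto simp: S_def)
  \<comment> \<open>The relation is the reversed strict order, so a maximal element for it is a
    minimal element of \<open>S\<close>.\<close>
  moreover have "asymp_on S (\<lambda>u v. leq v u \<and> u \<noteq> v)"
    unfolding asymp_on_def S_def using leq_antisym by blast
  moreover have "transp_on S (\<lambda>u v. leq v u \<and> u \<noteq> v)"
    unfolding transp_on_def S_def using leq_antisym leq_trans by blast
  ultimately obtain j where j: "j \<in> S" "\<And>i. \<lbrakk>i \<in> S; leq i j\<rbrakk> \<Longrightarrow> i = j"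
    using Finite_Set.bex_max_element[of S "\<lambda>u v. leq v u \<and> u \<noteq> v"] by metis
  have jI: "j \<in> I" "leq j x" "\<not> leq j y" using j(1) by (auto simp: S_def)
  have "leq j u \<or> leq j v" if uv: "u \<in> I" "v \<in> I" "leq j (m b u v)" for u v
  proof (rule ccontr)
    assume *: "\<not> (leq j u \<or> leq j v)"
    have below: "leq (m a j w) y" if "w \<in> I" "\<not> leq j w" for w
    proof (rule ccontr)
      assume "\<not> leq (m a j w) y"
      then have "m a j w \<in> S"
        using jI meet_leq(1)[OF jI(1) that(1)] leq_trans[of "m a j w" j x] m_I[OF a_I jI(1), of w]
          I_P[OF that(1)] assms(1)
        by (auto simp: S_def)
      then have "m a j w = j" using j(2) meet_leq(1) jI that by blast
      then show False using that by (simp add: leq_def)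
    qed
    have "j = m b (m a j u) (m a j v)"
      using uv(3) meet_join_distrib[OF jI(1) uv(1,2)] by (simp add: leq_def)
    moreover have "leq (m b (m a j u) (m a j v)) y"
      using below uv * jI assms(2) by (intro join_least m_I[OF a_I]) (auto intro: I_P)
    ultimately show False using jI(3) by simp
  qed
  moreover have "j \<noteq> a" 
    using jI(3) assms(2) a_in I_P by (auto simp: leq_def majority')
  ultimately have "j \<in> J" using jI(1) by (auto simp: J_def)
  then show ?thesis using jI by (auto simp: D_def)
qed

lemma D_mono_iff: "\<lbrakk>x \<in> I; y \<in> I\<rbrakk> \<Longrightarrow> D x \<subseteq> D y \<longleftrightarrow> leq x y"
  using D_separates[of x y] leq_trans[of _ x y] J_I by (fastforce simp: D_def)

lemma D_inj: "\<lbrakk>x \<in> I; y \<in> I; D x = D y\<rbrakk> \<Longrightarrow> x = y"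
  using D_mono_iff[of x y] D_mono_iff[of y x] leq_antisym[of x y] by simp

lemma D_prime: "\<lbrakk>q \<in> J; x \<in> I\<rbrakk> \<Longrightarrow> q \<in> D x \<longleftrightarrow> D q \<subseteq> D x"
  using D_mono_iff[of q x] J_I by (auto simp: D_def)

lemma D_a: "D a = {}"
  using a_in I_P J_I majority' unfolding D_def leq_def J_def by force

lemma D_b: "D b = J"
proof -
  have "leq j b" if "j \<in> J" for j
    unfolding leq_def using that J_I I_abs a_in b_in I_P by (metis perm(1) subsetD)
  then show ?thesis by (auto simp: D_def)
qed

text \<open>A common lower bound of two arguments is below the median (\<open>two\<close>).
  Conversely the median is below the join of any two arguments, so a join prime below it is below
  one of them (\<open>conv\<close>); applied to all three pairs, this gives at least two
  arguments.\<close>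

lemma D_m:
  assumes "x \<in> I" "y \<in> I" "z \<in> I"
  shows "D (m x y z) = (D x \<inter> D y) \<union> (D y \<inter> D z) \<union> (D z \<inter> D x)"
proof -
  have two: "leq j (m x y z)" if "x \<in> I" "y \<in> I" "z \<in> I" "j \<in> I" "leq j x" "leq j y" for x y z j
  proof -
    have "m (m x y z) a j = m (m x a j) (m y a j) z"
      using that a_in I_P by (intro distrib) auto
    also have "m x a j = j"
      using that a_in I_P by (metis leq_def perm(3))
    also have "m y a j = j"
      using that a_in I_P by (metis leq_def perm(3))
    finally show ?thesis
      unfolding leq_def using that a_in I_P closed by (simp add: perm majority')
  qed
  have conv: "leq j x \<or> leq j y" if "x \<in> I" "y \<in> I" "z \<in> I" "j \<in> J" "leq j (m x y z)" for x y z j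
  proof -
    define u where "u = m b x y"
    have u: "u \<in> I" unfolding u_def using that m_I[OF b_I] I_P by simp
    have "m (m x y z) b u = m (m x b u) (m y b u) z"
      using that b_in u I_P by (intro distrib) auto
    also have "m x b u = u"
      using that leq_join(1)[of x y] leq_iff_join[of x u] u u_def b_in I_P by (simp add: perm)
    also have "m y b u = u"
      using that leq_join(2)[of x y] leq_iff_join[of y u] u u_def b_in I_P by (simp add: perm)
    also have "m u u z = u" using u that I_P by (simp add: majority')
    finally have "leq (m x y z) u"
      using leq_iff_join[of "m x y z" u] u that m_I b_in I_P closed by (simp add: perm)
    then have "leq j u"
      using leq_trans[of j "m x y z" u] that u m_I J_I I_P by blast
    then show ?thesis using that u_def by (auto simp: J_def)
  qed
  have p: "m y z x = m x y z" "m z x y = m x y z"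
    using assms I_P perm by auto
  show ?thesis
  proof (intro equalityI subsetI)
    fix j assume "j \<in> D (m x y z)"
    then have "j \<in> J" "leq j (m x y z)" by (auto simp: D_def)
    then show "j \<in> D x \<inter> D y \<union> D y \<inter> D z \<union> D z \<inter> D x"
      using conv[of x y z j] conv[of y z x j] conv[of z x y j] assms p by (auto simp: D_def)
  next
    fix j assume "j \<in> D x \<inter> D y \<union> D y \<inter> D z \<union> D z \<inter> D x"
    then show "j \<in> D (m x y z)"
      using two[of x y z j] two[of y z x j] two[of z x y j] assms p J_I by (auto simp: D_def)
  qed
qed

lemma D_join: "\<lbrakk>x \<in> I; y \<in> I\<rbrakk> \<Longrightarrow> D (m b x y) = D x \<union> D y"
  and D_meet: "\<lbrakk>x \<in> I; y \<in> I\<rbrakk> \<Longrightarrow> D (m a x y) = D x \<inter> D y"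
  using D_m[OF b_I, of x y] D_m[OF a_I, of x y] D_a D_b D_sub[of x] D_sub[of y] by auto

lemma join_I: "\<lbrakk>x \<in> I; y \<in> I\<rbrakk> \<Longrightarrow> m b x y \<in> I" and meet_I: "\<lbrakk>x \<in> I; y \<in> I\<rbrakk> \<Longrightarrow> m a x y \<in> I"
  using m_I a_I b_I I_P by auto

section \<open>The rank bounds the width of the join primes\<close>

lemma D_Union:
  assumes "finite S" "\<And>s. s \<in> S \<Longrightarrow> \<exists>x\<in>I. D x = s"
  shows "\<exists>x\<in>I. D x = \<Union>S"
  using assms
proof (induction S)
  case empty
  then show ?case using a_I D_a by auto
next
  case (insert s S)
  then obtain x y where "x \<in> I" "D x = s" "y \<in> I" "D y = \<Union>S" by (metis insertCI)
  then show ?case using D_join[of x y] join_I[of x y] by auto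
qed

text \<open>The cube consists of the joins of subsets of \<open>Q\<close>, each enlarged by the
  common element \<open>c\<close>. With unions and intersections of the sets \<open>E f\<close>
  computed coordinatewise, \<open>D_m\<close> turns majority in the cube into the median.\<close>

lemma antichain_cube:
  assumes "Q \<subseteq> J" and anti: "\<And>p q. \<lbrakk>p \<in> Q; q \<in> Q; D p \<subseteq> D q\<rbrakk> \<Longrightarrow> p = q"
  shows "cube_embeds (card Q) P m"
proof -
  define n where "n = card Q"
  have finQ: "finite Q" using assms(1) finite_J finite_subset by blast
  then obtain q where q: "bij_betw q {..<n} Q"
    unfolding n_def using ex_bij_betw_nat_finite[OF finQ] by (auto simp: atLeast0LessThan)
  have qJ: "q i \<in> J" "q i \<in> I" if "i < n" for i
    using q that assms(1) J_I by (auto simp: bij_betw_def)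
  have q_anti: "i = j" if "i < n" "j < n" "D (q i) \<subseteq> D (q j)" for i j
    using anti[of "q i" "q j"] q that by (metis bij_betw_def image_eqI inj_onD lessThan_iff)
  txt \<open>Joining the pairwise meets \<open>c\<close> to everything makes the sets \<open>D (q i)\<close> disjoint relative to \<open>c\<close>,
    so that \<open>f \<mapsto> E f\<close> preserves intersections and not only unions.\<close>
  define c where "c = (\<Union>(i, j)\<in>{(i, j). i < n \<and> j < n \<and> i \<noteq> j}. D (q i) \<inter> D (q j))"
  define E where "E f = c \<union> (\<Union>i\<in>{i. i < n \<and> f i}. D (q i))" for f
  have E_ex: "\<exists>x\<in>I. D x = E f" for f :: "nat \<Rightarrow> bool"
  proof -
    define S where "S = (\<lambda>(i, j). D (q i) \<inter> D (q j)) ` {(i, j). i < n \<and> j < n \<and> i \<noteq> j} \<union> (\<lambda>i. D (q i)) ` {i. i < n \<and> f i}"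
    have "finite {(i, j). i < n \<and> j < n \<and> i \<noteq> j}"
      by (rule finite_subset[of _ "{..<n} \<times> {..<n}"]) auto
    then have "finite S" by (simp add: S_def)
    moreover have "\<exists>x\<in>I. D x = s" if "s \<in> S" for s
    proof -
      from that consider i j where "i < n" "j < n" "s = D (q i) \<inter> D (q j)" | i where "i < n" "s = D (q i)"
        unfolding S_def by auto
      then show ?thesis
      proof cases
        case (1 i j)
        then show ?thesis using D_meet[of "q i" "q j"] meet_I[of "q i" "q j"] qJ by blast
      next
        case (2 i)
        then show ?thesis using qJ by blast
      qed
    qed
    ultimately have "\<exists>x\<in>I. D x = \<Union>S" by (rule D_Union)
    moreover have "\<Union>S = E f" by (auto simp: S_def E_def c_def)
    ultimately show ?thesis by simp
  qed
  then obtain \<phi> where \<phi>: "\<And>f :: nat \<Rightarrow> bool. \<phi> f \<in> I" "\<And>f. D (\<phi> f) = E f" by metis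
  \<comment> \<open>Incomparability keeps \<open>q i\<close> out of \<open>D (q j)\<close> for
    \<open>j\<close> different from \<open>i\<close>, hence also out of \<open>c\<close>; so
    \<open>E f\<close> determines \<open>f\<close> on the coordinates.\<close>
  have q_E: "q i \<in> E f \<longleftrightarrow> f i" if "i < n" for i f
  proof -
    have "q i \<in> D (q i)" using qJ that D_prime by blast
    moreover have "i = j" if "j < n" "q i \<in> D (q j)" for j
      using q_anti[of i j] D_prime[of "q i" "q j"] qJ that \<open>i < n\<close> by blast
    ultimately show ?thesis using that unfolding E_def c_def by blast
  qed
  show ?thesis
    unfolding cube_embeds_def n_def[symmetric]
  proof (intro exI[of _ \<phi>] conjI ballI inj_onI)
    show "\<phi> \<in> cube n \<rightarrow> P" using \<phi>(1) I_P by auto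
  next
    fix f g assume fg: "f \<in> cube n" "g \<in> cube n" "\<phi> f = \<phi> g"
    then have "f i = g i" if "i < n" for i
      using q_E[OF that] \<phi>(2) by metis
    then show "f = g"
      using fg(1,2) unfolding cube_def by (intro PiE_ext[of f "{..<n}" _ g]) auto
  next
    fix f g h assume "f \<in> cube n" "g \<in> cube n" "h \<in> cube n"
    have "E (cube_median n f g h) = (E f \<inter> E g) \<union> (E g \<inter> E h) \<union> (E h \<inter> E f)"
    proof -
      have "D (q i) \<inter> D (q j) \<subseteq> c" if "i < n" "j < n" "i \<noteq> j" for i j
        using that by (auto simp: c_def)
      then have two: "E f \<inter> E g = E (\<lambda>i. f i \<and> g i)" for f g
        unfolding E_def by (intro equalityI) blast+
      have "E (cube_median n f g h) = E (\<lambda>i. f i \<and> g i) \<union> E (\<lambda>i. g i \<and> h i) \<union> E (\<lambda>i. h i \<and> f i)"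
        unfolding E_def cube_median_def by auto
      then show ?thesis
        by (simp add: two)
    qed
    then have "D (\<phi> (cube_median n f g h)) = D (m (\<phi> f) (\<phi> g) (\<phi> h))"
      using D_m \<phi> by simp
    then show "\<phi> (cube_median n f g h) = m (\<phi> f) (\<phi> g) (\<phi> h)"
      by (rule D_inj[OF \<phi>(1) m_I[OF \<phi>(1) \<phi>(1) I_P[OF \<phi>(1)]]])
  qed
qed

text \<open>In a smallest subfamily with the same join, every member lies above a join prime that is
  below no other member. These private join primes form an antichain, so there are at most
  \<open>\<eta>\<close> of them.\<close>

lemma join_of_few:
  assumes rank: "\<And>k. cube_embeds k P m \<Longrightarrow> k \<le> \<eta>" and "S \<subseteq> I"
  obtains T where "T \<subseteq> S" "card T \<le> \<eta>" "(\<Union>s\<in>T. D s) = (\<Union>s\<in>S. D s)"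
proof -
  have finS: "finite S" using assms(2) finite_I finite_subset by blast
  define ok where "ok T \<longleftrightarrow> T \<subseteq> S \<and> (\<Union>s\<in>T. D s) = (\<Union>s\<in>S. D s)" for T
  define T where "T = arg_min card ok"
  have T: "ok T" and Tmin: "\<And>T'. ok T' \<Longrightarrow> card T \<le> card T'"
    unfolding T_def using arg_min_nat_lemma[of ok S card] by (auto simp: ok_def)
  have finT: "finite T" using T finS finite_subset by (auto simp: ok_def)
  have "\<exists>p\<in>D s. \<forall>t\<in>T - {s}. p \<notin> D t" if "s \<in> T" for s
  proof (rule ccontr)
    assume "\<not> ?thesis"
    then have "(\<Union>t\<in>T - {s}. D t) = (\<Union>t\<in>T. D t)" using that by blast
    then have "ok (T - {s})" using T by (auto simp: ok_def)
    then show False using Tmin[of "T - {s}"] that finT card_Diff1_less[of T s] by simp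
  qed
  then obtain p where p: "\<And>s. s \<in> T \<Longrightarrow> p s \<in> D s" "\<And>s t. \<lbrakk>s \<in> T; t \<in> T; s \<noteq> t\<rbrakk> \<Longrightarrow> p s \<notin> D t"
    by (metis DiffI singletonD)
  have TI: "T \<subseteq> I" using T assms(2) by (auto simp: ok_def)
  have pJ: "p s \<in> J" if "s \<in> T" for s using p(1)[OF that] D_sub by blast
  have "s = t" if "s \<in> T" "t \<in> T" "D (p s) \<subseteq> D (p t)" for s t
  proof -
    have "D (p t) \<subseteq> D t" using D_prime[of "p t" t] p(1) pJ that TI by blast
    then have "p s \<in> D t" using D_prime[of "p s" t] pJ that TI by blast
    then show ?thesis using p(2) that by blast
  qed
  note anti = this
  have "inj_on p T" using anti by (auto intro: inj_onI)
  moreover have "cube_embeds (card (p ` T)) P m"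
    using anti pJ by (intro antichain_cube) auto
  ultimately have "card T \<le> \<eta>" using rank by (simp add: card_image)
  then show thesis using that T by (auto simp: ok_def)
qed

text \<open>Dilworth's theorem is applied to the sets \<open>D q\<close> under inclusion, because it
  is stated for a type-class order; injectivity of \<open>D\<close> transfers the width
  bound.\<close>

lemma chain_colouring:
  assumes rank: "\<And>k. cube_embeds k P m \<Longrightarrow> k \<le> \<eta>"
  obtains col :: "'p \<Rightarrow> nat" where "\<And>q. q \<in> J \<Longrightarrow> col q < \<eta>"
    and "\<And>p q. \<lbrakk>p \<in> J; q \<in> J; col p = col q\<rbrakk> \<Longrightarrow> D p \<subseteq> D q \<or> D q \<subseteq> D p"
proof -
  have inj: "inj_on D J" using D_inj J_I by (meson inj_onI subsetD)
  have "card R \<le> \<eta>" if R: "R \<subseteq> D ` J" "\<And>x y. \<lbrakk>x \<in> R; y \<in> R; x \<subseteq> y\<rbrakk> \<Longrightarrow> x = y" for R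
  proof -
    obtain Q where Q: "Q \<subseteq> J" "R = D ` Q" using R(1) by (meson subset_imageE)
    have "cube_embeds (card Q) P m"
      using Q R(2) inj by (intro antichain_cube) (auto simp: inj_on_def subset_iff)
    moreover have "card R = card Q"
      using Q inj inj_on_subset by (metis card_image)
    ultimately show ?thesis using rank by simp
  qed
  then obtain col :: "'p set \<Rightarrow> nat" where "\<And>x. x \<in> D ` J \<Longrightarrow> col x < \<eta>"
    "\<And>x y. \<lbrakk>x \<in> D ` J; y \<in> D ` J; col x = col y\<rbrakk> \<Longrightarrow> x \<subseteq> y \<or> y \<subseteq> x"
    using dilworth[of "D ` J" \<eta>] finite_J by blast
  then show thesis using that[of "\<lambda>q. col (D q)"] by auto
qed

end

section \<open>Lipschitz pseudometrics on intervals\<close>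

text \<open>\<open>d\<close> is meant to be the metric of the coarse median space pulled back along
  the map from \<open>P\<close>, so distinct points may have distance \<open>0\<close>;
  \<open>\<delta>\<close> absorbs the errors of (C1) and (C2).\<close>

locale lipschitz_median_interval = median_interval P m a b for P :: "'p set" and m a b +
  fixes d :: "'p \<Rightarrow> 'p \<Rightarrow> real" and K \<delta> :: real and \<eta> :: nat
  assumes rank: "cube_embeds k P m \<Longrightarrow> k \<le> \<eta>"
    and d_nonneg: "0 \<le> d x y"
    and d_self: "x \<in> P \<Longrightarrow> d x x = 0"
    and d_sym: "d x y = d y x"
    and d_triangle: "\<lbrakk>x \<in> P; y \<in> P; z \<in> P\<rbrakk> \<Longrightarrow> d x z \<le> d x y + d y z"
    and K_ge_1: "1 \<le> K" and \<delta>_nonneg: "0 \<le> \<delta>"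
    and lipschitz: "\<lbrakk>x \<in> P; y \<in> P; z \<in> P; x' \<in> P; y' \<in> P; z' \<in> P\<rbrakk>
      \<Longrightarrow> d (m x y z) (m x' y' z') \<le> K * (d x x' + d y y' + d z z') + \<delta>"
begin

lemma d_join:
  assumes "x \<in> P" "y \<in> P" "x' \<in> P" "y' \<in> P"
  shows "d (m b x y) (m b x' y') \<le> K * (d x x' + d y y') + \<delta>"
  using lipschitz[of b x y b x' y'] assms b_in d_self by simp

lemma d_meet:
  assumes "x \<in> P" "y \<in> P" "x' \<in> P" "y' \<in> P"
  shows "d (m a x y) (m a x' y') \<le> K * (d x x' + d y y') + \<delta>"
  using lipschitz[of a x y a x' y'] assms a_in d_self by simp

text \<open>Each binary join costs a factor \<open>K\<close>, so the bound is exponential in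
  \<open>card T\<close>. It is useful only for families whose size is bounded beforehand.\<close>

lemma finite_join_bound:
  assumes "finite T" "T \<subseteq> I" "\<And>t. t \<in> T \<Longrightarrow> d a t \<le> R" "0 \<le> R"
  shows "\<exists>w\<in>I. D w = (\<Union>t\<in>T. D t) \<and> d a w \<le> card T * K ^ card T * (R + \<delta>)"
  using assms
proof (induction T)
  case empty
  then show ?case using a_I D_a d_self a_in by auto
next
  case (insert t T)
  then obtain w where w: "w \<in> I" "D w = (\<Union>t\<in>T. D t)" "d a w \<le> card T * K ^ card T * (R + \<delta>)"
    by auto
  have t: "t \<in> I" "d a t \<le> R" using insert.prems by auto
  define k where "k = card T"
  have K1: "1 \<le> K ^ k" "1 \<le> K * K ^ k" using K_ge_1 one_le_power[of K k] mult_mono[of 1 K 1 "K ^ k"] by auto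
  have "d a (m b t w) \<le> K * (d a t + d a w) + \<delta>"
    using d_join[of a a t w] majority'(3)[OF a_in b_in] t w a_in I_P by simp
  also have "\<dots> \<le> K * (R + k * K ^ k * (R + \<delta>)) + \<delta>"
    using t w(3) K_ge_1 by (intro add_mono mult_left_mono) (auto simp: k_def)
  also have "\<dots> \<le> (K * R + \<delta>) + k * (K * K ^ k) * (R + \<delta>)"
    by (simp add: algebra_simps)
  also have "K * R + \<delta> \<le> K * K ^ k * (R + \<delta>)"
  proof -
    have "K * R \<le> K * K ^ k * R"
      using mult_right_mono[of K "K * K ^ k" R] K1 K_ge_1 assms(4) by simp
    moreover have "\<delta> \<le> K * K ^ k * \<delta>"
      using mult_right_mono[OF K1(2) \<delta>_nonneg] by simp
    ultimately show ?thesis by (simp add: algebra_simps)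
  qed
  finally have "d a (m b t w) \<le> Suc k * K ^ Suc k * (R + \<delta>)"
    by (simp add: algebra_simps)
  moreover have "D (m b t w) = (\<Union>t\<in>insert t T. D t)" "m b t w \<in> I"
    using D_join[OF t(1) w(1)] join_I[OF t(1) w(1)] w(2) by auto
  ultimately show ?case
    using insert.hyps by (intro bexI[of _ "m b t w"]) (auto simp: k_def)
qed

text \<open>The bound does not involve the size of \<open>S\<close>, since
  \<open>join_of_few\<close> leaves at most \<open>\<eta>\<close> members. The last two conclusions
  both express that \<open>h\<close> is above \<open>s\<close>, in median form so that they survive
  the passage to the coarse space.\<close>

lemma join_exists:
  assumes "S \<subseteq> I" "\<And>s. s \<in> S \<Longrightarrow> d a s \<le> R" "0 \<le> R"
  obtains h where "h \<in> I" "d a h \<le> \<eta> * K ^ \<eta> * (R + \<delta>)"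
    "\<And>s. s \<in> S \<Longrightarrow> m a h s = s" "\<And>s. s \<in> S \<Longrightarrow> m s h b = h"
proof -
  obtain T where T: "T \<subseteq> S" "card T \<le> \<eta>" "(\<Union>s\<in>T. D s) = (\<Union>s\<in>S. D s)"
    using join_of_few[OF rank assms(1)] by blast
  have "finite T" using finite_subset[OF order_trans[OF T(1) assms(1)] finite_I] .
  then have "\<exists>w\<in>I. D w = (\<Union>t\<in>T. D t) \<and> d a w \<le> card T * K ^ card T * (R + \<delta>)"
    using T(1) assms by (intro finite_join_bound) auto
  then obtain h where h: "h \<in> I" "D h = (\<Union>s\<in>S. D s)" "d a h \<le> card T * K ^ card T * (R + \<delta>)"
    unfolding T(3) by metis
  have "card T * K ^ card T \<le> \<eta> * K ^ \<eta>"
    using T(2) K_ge_1 by (intro mult_mono power_increasing) auto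
  then have "card T * K ^ card T * (R + \<delta>) \<le> \<eta> * K ^ \<eta> * (R + \<delta>)"
    using assms(3) \<delta>_nonneg by (intro mult_right_mono) auto
  with h(3) have "d a h \<le> \<eta> * K ^ \<eta> * (R + \<delta>)"
    by linarith
  moreover have "m a h s = s" "m s h b = h" if s: "s \<in> S" for s
  proof -
    have sI: "s \<in> I" and sub: "D s \<subseteq> D h" using s assms(1) h(2) by auto
    show "m a h s = s"
      using sub by (intro D_inj) (auto simp: D_m D_a sI h(1) a_I intro: meet_I)
    show "m s h b = h"
      using sub D_sub[of h] by (intro D_inj) (auto simp: D_m D_b sI h(1) b_I b_in intro: m_I)
  qed
  ultimately show thesis using that h(1) by blast
qed

text \<open>Project the path into the interval and replace every point by the join of all points up
  to it. Each of the two operations applies the Lipschitz estimate once to a step.\<close>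

lemma monotone_path:
  assumes g: "\<And>j. g j \<in> P" "g 0 = a" "g n = b" and step: "\<And>j. j < n \<Longrightarrow> d (g j) (g (Suc j)) \<le> \<theta>"
  obtains w where "\<And>j. w j \<in> I" "\<And>j. D (w j) \<subseteq> D (w (Suc j))" "w 0 = a" "w n = b"
    "\<And>j. j < n \<Longrightarrow> d (w j) (w (Suc j)) \<le> K * (K * \<theta> + \<delta>) + \<delta>"
proof -
  define g' where "g' j = m a b (g j)" for j
  define w where "w = rec_nat a (\<lambda>j u. m b u (g' (Suc j)))"
  have w_simps: "w 0 = a" "\<And>j. w (Suc j) = m b (w j) (g' (Suc j))"
    by (auto simp: w_def)
  have g'I: "g' j \<in> I" for j using project_I g by (simp add: g'_def)
  have wI: "w j \<in> I" for j
    by (induction j) (auto simp: w_simps a_I join_I g'I)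
  have D_Suc: "D (w (Suc j)) = D (w j) \<union> D (g' (Suc j))" for j
    using D_join wI g'I by (simp add: w_simps)
  have below: "D (g' j) \<subseteq> D (w j)" for j
    using D_Suc by (cases j) (auto simp: g'_def g w_simps majority' a_in b_in)
  have "g' n = b" using a_in b_in by (simp add: g'_def g majority')
  then have "D (w n) = J" using below[of n] D_b D_sub by auto
  then have "w n = b" using D_inj[OF wI b_I] D_b by simp
  moreover have "d (w j) (w (Suc j)) \<le> K * (K * \<theta> + \<delta>) + \<delta>" if "j < n" for j
  proof -
    \<comment> \<open>Since \<open>w j\<close> already contains \<open>g' j\<close>, both
      \<open>w j\<close> and \<open>w (Suc j)\<close> are joins with \<open>w j\<close>, of
      \<open>g' j\<close> and \<open>g' (Suc j)\<close> respectively; errors of earlier steps do not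
      accumulate.\<close>
    have absorb: "m b (w j) (g' j) = w j"
      using below[of j] D_join[OF wI g'I] wI g'I join_I by (intro D_inj) auto
    have "d (g' j) (g' (Suc j)) \<le> K * d (g j) (g (Suc j)) + \<delta>"
      using d_meet[of b "g j" b "g (Suc j)"] g b_in d_self by (simp add: g'_def)
    also have "\<dots> \<le> K * \<theta> + \<delta>"
      using step[OF that] K_ge_1 by simp
    finally have g'_step: "d (g' j) (g' (Suc j)) \<le> K * \<theta> + \<delta>" .
    have "d (w j) (w (Suc j)) \<le> K * d (g' j) (g' (Suc j)) + \<delta>"
      using d_join[of "w j" "g' j" "w j" "g' (Suc j)"] absorb wI g'I I_P d_self by (simp add: w_simps)
    also have "\<dots> \<le> K * (K * \<theta> + \<delta>) + \<delta>"
      using g'_step K_ge_1 by simp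
    finally show ?thesis .
  qed
  ultimately show thesis using that wI D_Suc w_simps(1) by blast
qed

text \<open>Cut the join primes into \<open>\<eta>\<close> chains and into the \<open>n\<close> layers of a monotone path from \<open>a\<close>
  to \<open>b\<close>, and record for each chain the layer at which an element stops. Two elements with the same
  record differ in at most \<open>\<eta>\<close> layers, each of which is as short as a step of the path.\<close>

lemma card_separated_le:
  assumes w: "\<And>j. w j \<in> I" "\<And>j. D (w j) \<subseteq> D (w (Suc j))" "w 0 = a" "w n = b"
    and step: "\<And>j. j < n \<Longrightarrow> d (w j) (w (Suc j)) \<le> s"
    and "0 \<le> s" "S \<subseteq> I"
    and sep: "\<And>x y. \<lbrakk>x \<in> S; y \<in> S; x \<noteq> y\<rbrakk> \<Longrightarrow> d x y > 2 * \<eta> * (K * (K * s + \<delta>) + \<delta>)"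
  shows "card S \<le> (n + 1) ^ \<eta>"
proof -
  obtain col where col: "\<And>q. q \<in> J \<Longrightarrow> col q < \<eta>"
    and chain: "\<And>p q. \<lbrakk>p \<in> J; q \<in> J; col p = col q\<rbrakk> \<Longrightarrow> D p \<subseteq> D q \<or> D q \<subseteq> D p"
    using chain_colouring[OF rank] by blast
  define B where "B = K * (K * s + \<delta>) + \<delta>"
  have B: "0 \<le> B" using K_ge_1 \<delta>_nonneg \<open>0 \<le> s\<close> by (simp add: B_def)
  define part where "part x t = {q \<in> D x. col q = t}" for x t
  define code where "code x t = (LEAST j. part x t \<subseteq> D (w j))" for x t
  have part_top: "part x t \<subseteq> D (w n)" for x t
    using w(4) D_b D_sub by (auto simp: part_def)
  then have code: "part x t \<subseteq> D (w (code x t))" and code_le: "part x t \<subseteq> D (w j) \<Longrightarrow> code x t \<le> j" for x t j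
    unfolding code_def using LeastI[of "\<lambda>j. part x t \<subseteq> D (w j)" n] by (blast, simp add: Least_le)
  have w_mono: "D (w i) \<subseteq> D (w j)" if "i \<le> j" for i j
    using lift_Suc_mono_le[of "\<lambda>j. D (w j)"] w(2) that by blast
  \<comment> \<open>Interpolate from \<open>x\<close> to \<open>y\<close> by adding to
    \<open>x\<close> what \<open>y\<close> has in one more layer at a time: \<open>z 0 = x\<close>,
    \<open>z n = y\<close>, and \<open>z\<close> moves only at recorded layers.\<close>
  have close: "d x y \<le> \<eta> * B" if xy: "x \<in> I" "y \<in> I" "D x \<subseteq> D y"
    and eq: "\<And>t. t < \<eta> \<Longrightarrow> code x t = code y t" for x y
  proof -
    define z where "z i = m b x (m a y (w i))" for i
    have Dz: "D (z i) = D x \<union> (D y \<inter> D (w i))" and zI: "z i \<in> I" for i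
      using xy w(1) D_join D_meet join_I meet_I by (auto simp: z_def)
    \<comment> \<open>A join prime \<open>q\<close> gained at layer \<open>Suc i\<close> is not
      below \<open>x\<close>, so all of \<open>x\<close> in the chain of \<open>q\<close> is below
      \<open>q\<close> and stops by layer \<open>Suc i\<close>. But \<open>q\<close> itself keeps
      \<open>y\<close> from stopping earlier, and the records agree.\<close>
    have z_eq: "z i = z (Suc i)" if "Suc i \<notin> code x ` {..<\<eta>}" for i
    proof (rule ccontr)
      assume "z i \<noteq> z (Suc i)"
      then have "D (z i) \<noteq> D (z (Suc i))" using D_inj zI by blast
      then obtain q where q: "q \<in> D y" "q \<in> D (w (Suc i))" "q \<notin> D x" "q \<notin> D (w i)"
        using Dz w(2)[of i] by auto
      then have qJ: "q \<in> J" using D_sub by blast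
      have "part x (col q) \<subseteq> D (w (Suc i))"
      proof
        fix p assume "p \<in> part x (col q)"
        then have p: "p \<in> D x" "p \<in> J" "col p = col q" using D_sub by (auto simp: part_def)
        then have "D p \<subseteq> D q" using chain[of p q] D_prime[OF p(2) xy(1)] D_prime[OF qJ xy(1)] qJ q(3) by blast
        then show "p \<in> D (w (Suc i))"
          using D_prime[OF p(2) w(1)] D_prime[OF qJ w(1)] q(2) by blast
      qed
      then have "code x (col q) \<le> Suc i" by (rule code_le)
      moreover have "Suc i \<le> code y (col q)"
      proof (rule ccontr)
        assume "\<not> Suc i \<le> code y (col q)"
        then have "D (w (code y (col q))) \<subseteq> D (w i)" by (intro w_mono) simp
        then show False using code[of y "col q"] q(1,4) by (auto simp: part_def)
      qed
      ultimately have "code x (col q) = Suc i" using eq[OF col[OF qJ]] by simp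
      then show False using that col[OF qJ] by force
    qed
    have z_step: "d (z i) (z (Suc i)) \<le> (if Suc i \<in> code x ` {..<\<eta>} then B else 0)" if "i < n" for i
    proof (cases "Suc i \<in> code x ` {..<\<eta>}")
      case True
      have "d (z i) (z (Suc i)) \<le> K * d (m a y (w i)) (m a y (w (Suc i))) + \<delta>"
        unfolding z_def using d_join[of x "m a y (w i)" x "m a y (w (Suc i))"] xy w(1) I_P closed a_in d_self by simp
      also have "\<dots> \<le> K * (K * s + \<delta>) + \<delta>"
      proof -
        have "d (m a y (w i)) (m a y (w (Suc i))) \<le> K * d (w i) (w (Suc i)) + \<delta>"
          using d_meet[of y "w i" y "w (Suc i)"] xy w(1) I_P d_self by simp
        also have "\<dots> \<le> K * s + \<delta>" using step[OF that] K_ge_1 by simp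
        finally show ?thesis using K_ge_1 by simp
      qed
      finally show ?thesis using True by (simp add: B_def)
    next
      case False
      then show ?thesis using z_eq d_self zI I_P by simp
    qed
    have "d (z 0) (z j) \<le> (\<Sum>i<j. if Suc i \<in> code x ` {..<\<eta>} then B else 0)" if "j \<le> n" for j
      using that
    proof (induction j)
      case 0
      then show ?case using d_self zI I_P by simp
    next
      case (Suc j)
      have "d (z 0) (z (Suc j)) \<le> d (z 0) (z j) + d (z j) (z (Suc j))"
        using d_triangle zI I_P by blast
      then show ?case using Suc z_step[of j] by simp
    qed
    from this[of n] have "d (z 0) (z n) \<le> card ({..<n} \<inter> {i. Suc i \<in> code x ` {..<\<eta>}}) * B"
      by (simp add: sum.If_cases)
    also have "\<dots> \<le> \<eta> * B"
    proof -
      have "card ({..<n} \<inter> {i. Suc i \<in> code x ` {..<\<eta>}}) \<le> card (code x ` {..<\<eta>})"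
        by (rule card_inj_on_le[of Suc]) auto
      also have "\<dots> \<le> \<eta>" using card_image_le[of "{..<\<eta>}" "code x"] by simp
      finally show ?thesis using B by (simp add: mult_right_mono)
    qed
    also have "z 0 = x" using D_inj[OF zI xy(1)] Dz D_a w(3) by auto
    also have "z n = y" 
    proof (rule D_inj[OF zI xy(2)])
      have "D y \<subseteq> D (w n)" using w(4) D_b D_sub by simp
      then show "D (z n) = D y" using Dz xy(3) by auto
    qed
    finally show ?thesis .
  qed
  have "inj_on (\<lambda>x. restrict (code x) {..<\<eta>}) S"
  proof (rule inj_onI, rule ccontr)
    fix x y assume xy: "x \<in> S" "y \<in> S" "restrict (code x) {..<\<eta>} = restrict (code y) {..<\<eta>}" "x \<noteq> y"
    have eq: "code x t = code y t" if "t < \<eta>" for t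
      using fun_cong[OF xy(3), of t] that by simp
    have I: "x \<in> I" "y \<in> I" using xy \<open>S \<subseteq> I\<close> by auto
    \<comment> \<open>\<open>close\<close> needs comparable elements, so pass through the meet.
      Within a chain the parts of \<open>x\<close> and \<open>y\<close> are nested, hence
      \<open>u\<close> has the same record as both.\<close>
    define u where "u = m a x y"
    have u: "u \<in> I" "D u = D x \<inter> D y" using I meet_I D_meet by (auto simp: u_def)
    have "code u t = code x t" if "t < \<eta>" for t
    proof -
      have "part x t \<subseteq> part y t \<or> part y t \<subseteq> part x t"
      proof (rule ccontr)
        assume "\<not> ?thesis"
        then obtain p q where "p \<in> part x t" "p \<notin> part y t" "q \<in> part y t" "q \<notin> part x t"
          by (meson subsetI)
        then have pq: "p \<in> D x" "p \<notin> D y" "q \<in> D y" "q \<notin> D x" "col p = col q"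
          by (auto simp: part_def)
        then have "p \<in> J" "q \<in> J" using D_sub by auto
        then show False using pq chain[of p q] D_prime I by blast
      qed
      then have "part u t = part x t \<or> part u t = part y t"
        using u(2) by (auto simp: part_def)
      then show ?thesis using eq[OF that] by (auto simp: code_def)
    qed
    then have "d u x \<le> \<eta> * B" "d u y \<le> \<eta> * B"
      using eq close[OF u(1) I(1)] close[OF u(1) I(2)] u(2) by auto
    moreover have "d x y \<le> d u x + d u y"
      using d_triangle[of x u y] d_sym[of x u] I u I_P by simp
    ultimately show False using sep[OF xy(1,2,4)] by (simp add: B_def)
  qed
  moreover have "(\<lambda>x. restrict (code x) {..<\<eta>}) ` S \<subseteq> {..<\<eta>} \<rightarrow>\<^sub>E {..n}"
    using code_le[OF part_top] by (intro image_subsetI restrict_PiE_iff[THEN iffD2]) auto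
  moreover have "finite ({..<\<eta>} \<rightarrow>\<^sub>E {..n})" by (simp add: finite_PiE)
  ultimately have "card S \<le> card ({..<\<eta>} \<rightarrow>\<^sub>E {..n})"
    by (metis card_inj_on_le)
  then show ?thesis by (simp add: card_PiE)
qed

end

section \<open>Intervals in coarse median spaces\<close>

text \<open>A largest separated set is a net. Only size exactly \<open>Suc N\<close> has to be
  excluded, since a larger separated set contains one of that size; this suits estimates whose
  errors depend on the number of points.\<close>

lemma (in Metric_space) exists_net:
  assumes "Z \<subseteq> M"
    and bound: "\<And>T. \<lbrakk>T \<subseteq> Z; finite T; \<And>x y. \<lbrakk>x \<in> T; y \<in> T; x \<noteq> y\<rbrakk> \<Longrightarrow> d x y > e\<rbrakk> \<Longrightarrow> card T \<noteq> Suc N"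
  obtains T where "T \<subseteq> Z" "finite T" "card T \<le> N" "\<And>z. z \<in> Z \<Longrightarrow> \<exists>t\<in>T. d z t \<le> max e 0"
proof -
  define sep where "sep T \<longleftrightarrow> T \<subseteq> Z \<and> finite T \<and> (\<forall>x\<in>T. \<forall>y\<in>T. x \<noteq> y \<longrightarrow> d x y > e)" for T
  have le: "card T \<le> N" if "sep T" for T
  proof (rule ccontr)
    assume "\<not> card T \<le> N"
    then obtain T' where T': "T' \<subseteq> T" "card T' = Suc N" "finite T'"
      using obtain_subset_with_card_n[of "Suc N" T] by (metis not_less_eq_eq)
    have "T' \<subseteq> Z" "\<And>x y. \<lbrakk>x \<in> T'; y \<in> T'; x \<noteq> y\<rbrakk> \<Longrightarrow> d x y > e"
      using T'(1) \<open>sep T\<close> by (auto simp: sep_def)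
    from bound[OF this(1) T'(3) this(2)] T'(2) show False by simp
  qed
  have "sep {}" by (simp add: sep_def)
  then obtain T where T: "sep T" "\<And>T'. sep T' \<Longrightarrow> card T' \<le> card T"
    using ex_has_greatest_nat[of sep "{}" card "Suc N"] le by (metis le_imp_less_Suc)
  have "\<exists>t\<in>T. d z t \<le> max e 0" if z: "z \<in> Z" for z
  proof (rule ccontr)
    assume *: "\<not> ?thesis"
    then have "z \<notin> T" using z assms(1) by force
    moreover have "sep (insert z T)"
      using T(1) z * unfolding sep_def by (auto simp: commute not_le)
    ultimately show False using T(2)[of "insert z T"] T(1) by (simp add: sep_def)
  qed
  then show thesis using that T(1) le[OF T(1)] by (auto simp: sep_def)
qed

text \<open>Pick the vertices of a shortest path at positions \<open>j * L div n\<close>; rounding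
  costs at most \<open>1\<close>. The cutoff \<open>min j n\<close> keeps \<open>g\<close> in
  \<open>M\<close> for every index.\<close>

lemma (in Metric_space) discretized_geodesic:
  assumes "discretely_geodesic M d" "x \<in> M" "y \<in> M" "n > 0"
  obtains g where "\<And>j. g j \<in> M" "g 0 = x" "g n = y" "\<And>j. j < n \<Longrightarrow> d (g j) (g (Suc j)) \<le> d x y / n + 1"
proof -
  obtain E where E: "E \<subseteq> M \<times> M" "\<And>x y. \<lbrakk>x \<in> M; y \<in> M\<rbrakk> \<Longrightarrow> (x, y) \<in> E\<^sup>*"
    "\<And>x y. \<lbrakk>x \<in> M; y \<in> M\<rbrakk> \<Longrightarrow> d x y = real (LEAST n. (x, y) \<in> E ^^ n)"
    using assms(1) unfolding discretely_geodesic_def by blast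
  define L where "L = (LEAST n. (x, y) \<in> E ^^ n)"
  obtain k where "(x, y) \<in> E ^^ k"
    using E(2) assms(2,3) rtrancl_imp_relpow by metis
  then have "(x, y) \<in> E ^^ L" unfolding L_def by (rule LeastI)
  then obtain v where v: "v 0 = x" "v L = y" "\<And>i. i < L \<Longrightarrow> (v i, v (Suc i)) \<in> E"
    by (auto simp: relpow_fun_conv)
  have vM: "v i \<in> M" if "i \<le> L" for i
    using that v E(1) assms(2) by (cases i) (auto simp: Suc_le_eq)
  have edge: "d (v i) (v (Suc i)) \<le> 1" if "i < L" for i
  proof -
    have "(v i, v (Suc i)) \<in> E ^^ 1" using v(3)[OF that] by simp
    then have "(LEAST n. (v i, v (Suc i)) \<in> E ^^ n) \<le> 1" by (rule Least_le)
    then show ?thesis using E(3)[of "v i" "v (Suc i)"] vM that by simp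
  qed
  have path: "d (v i) (v (i + k)) \<le> real k" if "i + k \<le> L" for i k
    using that
  proof (induction k)
    case 0
    then show ?case using vM by simp
  next
    case (Suc k)
    have "d (v i) (v (i + Suc k)) \<le> d (v i) (v (i + k)) + d (v (i + k)) (v (Suc (i + k)))"
      using triangle[of "v i" "v (i + k)" "v (Suc (i + k))"] vM Suc.prems by simp
    then show ?case using Suc edge[of "i + k"] by simp
  qed
  define g where "g j = v (min j n * L div n)" for j
  have le: "min j n * L div n \<le> L" for j
  proof -
    have "min j n * L div n \<le> n * L div n" by (intro div_le_mono mult_le_mono1) simp
    then show ?thesis using assms(4) by simp
  qed
  have "d (g j) (g (Suc j)) \<le> d x y / n + 1" if "j < n" for j
  proof -
    have mono: "j * L div n \<le> Suc j * L div n" by (intro div_le_mono mult_le_mono1) simp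
    then obtain k where k: "Suc j * L div n = j * L div n + k" using le_Suc_ex by blast
    have "d (g j) (g (Suc j)) \<le> real k"
      using path[of "j * L div n" k] le[of "Suc j"] that k by (simp add: g_def min_def)
    also have "real k = real (Suc j * L div n) - real (j * L div n)" using k by simp
    also have "\<dots> \<le> real (Suc j * L) / n - (real (j * L) / n - 1)"
    proof -
      have "real_of_int \<lfloor>real (j * L) / real n\<rfloor> = real (j * L div n)"
        by (simp only: floor_divide_of_nat_eq of_int_of_nat_eq)
      then have "real (j * L) / n - 1 \<le> real (j * L div n)" by linarith
      then show ?thesis using of_nat_div_le_of_nat[of "Suc j * L" n, where 'a = real] by linarith
    qed
    also have "\<dots> = L / n + 1" by (simp add: add_divide_distrib ring_distribs)
    finally show ?thesis using E(3)[OF assms(2,3)] by (simp add: L_def)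
  qed
  then show thesis
    using that[of g] le vM v assms(4) by (auto simp: g_def)
qed

section \<open>Transfer between the coarse space and finite median algebras\<close>

locale finite_rank_coarse_median = Metric_space X \<rho>
  for X :: "'a set" and \<rho> :: "'a \<Rightarrow> 'a \<Rightarrow> real" +
  fixes \<mu> :: "'a \<Rightarrow> 'a \<Rightarrow> 'a \<Rightarrow> 'a" and K H0 :: real and H :: "nat \<Rightarrow> real" and \<eta> :: nat
  assumes \<mu>_closed: "\<lbrakk>a \<in> X; b \<in> X; c \<in> X\<rbrakk> \<Longrightarrow> \<mu> a b c \<in> X"
    and K_ge_1: "1 \<le> K" and H0_nonneg: "0 \<le> H0" and H_nonneg: "0 \<le> H p"
    and \<mu>_lipschitz: "\<lbrakk>a \<in> X; b \<in> X; c \<in> X; a' \<in> X; b' \<in> X; c' \<in> X\<rbrakk>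
      \<Longrightarrow> \<rho> (\<mu> a b c) (\<mu> a' b' c') \<le> K * (\<rho> a a' + \<rho> b b' + \<rho> c c') + H0"
    and finite_approximation: "\<lbrakk>A \<subseteq> X; finite A; 1 \<le> card A; card A \<le> p\<rbrakk>
      \<Longrightarrow> \<exists>(P :: nat set) m. finite P \<and> median_algebra P m \<and> median_rank P m \<le> \<eta> \<and>
             approximates X \<rho> \<mu> (H p) A P m"
begin

text \<open>A single error for \<open>p\<close> points. It dominates \<open>H0 + 2 * H p\<close>,
  the additive Lipschitz error of the pulled-back metric, and \<open>H0 + (3 * K + 1) * H p\<close>,
  the error for medians of approximated points.\<close>

definition E :: "nat \<Rightarrow> real" where
  "E p = H0 + (3 * K + 2) * H p"

lemma H_le_E: "H p \<le> E p" "H0 + 2 * H p \<le> E p" "H0 \<le> E p" "0 \<le> E p"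
proof -
  have "2 * H p \<le> (3 * K + 2) * H p" using K_ge_1 H_nonneg by (intro mult_right_mono) auto
  then show "H p \<le> E p" "H0 + 2 * H p \<le> E p" "H0 \<le> E p" "0 \<le> E p"
    using H_nonneg[of p] H0_nonneg by (auto simp: E_def)
qed

text \<open>The interval locale is provided for every pair of points of \<open>A\<close>, so that
  each application may choose its own endpoints.\<close>

definition approx_map ::
    "'a set \<Rightarrow> real \<Rightarrow> nat set \<Rightarrow> (nat \<Rightarrow> nat \<Rightarrow> nat \<Rightarrow> nat) \<Rightarrow> ('a \<Rightarrow> nat) \<Rightarrow> (nat \<Rightarrow> 'a) \<Rightarrow> bool" where
  "approx_map A e P m \<pi> l \<longleftrightarrow>
     (\<forall>a\<in>A. \<forall>b\<in>A. lipschitz_median_interval P m (\<pi> a) (\<pi> b) (\<lambda>x y. \<rho> (l x) (l y)) K e \<eta>) \<and>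
     \<pi> \<in> A \<rightarrow> P \<and> l \<in> P \<rightarrow> X \<and>
     (\<forall>x\<in>P. \<forall>y\<in>P. \<forall>z\<in>P. \<rho> (l (m x y z)) (\<mu> (l x) (l y) (l z)) \<le> e) \<and>
     (\<forall>a\<in>A. \<rho> a (l (\<pi> a)) \<le> e) \<and>
     (\<forall>a\<in>A. \<forall>b\<in>A. \<forall>c\<in>A. \<rho> (l (m (\<pi> a) (\<pi> b) (\<pi> c))) (\<mu> a b c) \<le> e)"

lemma approx_mapD:
  assumes "approx_map A e P m \<pi> l"
  shows "\<lbrakk>a \<in> A; b \<in> A\<rbrakk> \<Longrightarrow> lipschitz_median_interval P m (\<pi> a) (\<pi> b) (\<lambda>x y. \<rho> (l x) (l y)) K e \<eta>"
    "a \<in> A \<Longrightarrow> \<pi> a \<in> P" "x \<in> P \<Longrightarrow> l x \<in> X"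
    "\<lbrakk>x \<in> P; y \<in> P; z \<in> P\<rbrakk> \<Longrightarrow> \<rho> (l (m x y z)) (\<mu> (l x) (l y) (l z)) \<le> e"
    "a \<in> A \<Longrightarrow> \<rho> a (l (\<pi> a)) \<le> e"
    "\<lbrakk>a \<in> A; b \<in> A; c \<in> A\<rbrakk> \<Longrightarrow> \<rho> (l (m (\<pi> a) (\<pi> b) (\<pi> c))) (\<mu> a b c) \<le> e"
  using assms unfolding approx_map_def by blast+

lemma approximation:
  assumes "A \<subseteq> X" "finite A" "A \<noteq> {}" "card A \<le> p"
  shows "\<exists>P m \<pi> l. approx_map A (E p) P m \<pi> l"
proof -
  have "1 \<le> card A" using assms by (simp add: Suc_le_eq card_gt_0_iff)
  then obtain P :: "nat set" and m where P: "finite P" "median_algebra P m" "median_rank P m \<le> \<eta>"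
      "approximates X \<rho> \<mu> (H p) A P m"
    using finite_approximation assms by blast
  from P(4) obtain \<pi> l where \<pi>: "\<And>a. a \<in> A \<Longrightarrow> \<pi> a \<in> P" and l: "\<And>x. x \<in> P \<Longrightarrow> l x \<in> X"
    and lm: "\<And>x y z. \<lbrakk>x \<in> P; y \<in> P; z \<in> P\<rbrakk> \<Longrightarrow> \<rho> (l (m x y z)) (\<mu> (l x) (l y) (l z)) \<le> H p"
    and l\<pi>: "\<And>a. a \<in> A \<Longrightarrow> \<rho> a (l (\<pi> a)) \<le> H p"
    unfolding approximates_def by blast
  interpret median_algebra P m by (rule P(2))
  have lip: "\<rho> (l (m x y z)) (l (m x' y' z'))
      \<le> K * (\<rho> (l x) (l x') + \<rho> (l y) (l y') + \<rho> (l z) (l z')) + E p"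
    if "x \<in> P" "y \<in> P" "z \<in> P" "x' \<in> P" "y' \<in> P" "z' \<in> P" for x y z x' y' z'
  proof -
    define u where "u = \<mu> (l x) (l y) (l z)"
    define u' where "u' = \<mu> (l x') (l y') (l z')"
    have X: "u \<in> X" "u' \<in> X" "l (m x y z) \<in> X" "l (m x' y' z') \<in> X"
      using that l closed \<mu>_closed by (auto simp: u_def u'_def)
    have "\<rho> (l (m x y z)) (l (m x' y' z')) \<le> \<rho> (l (m x y z)) u + \<rho> u u' + \<rho> (l (m x' y' z')) u'"
      using triangle[of "l (m x y z)" u "l (m x' y' z')"] triangle[of u u' "l (m x' y' z')"] X
        commute[of u' "l (m x' y' z')"] by linarith
    moreover have "\<rho> u u' \<le> K * (\<rho> (l x) (l x') + \<rho> (l y) (l y') + \<rho> (l z) (l z')) + H0"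
      unfolding u_def u'_def using that l by (intro \<mu>_lipschitz) auto
    ultimately show ?thesis
      using lm[of x y z] lm[of x' y' z'] that H_le_E(2)[of p] by (simp add: u_def u'_def)
  qed
  show ?thesis
    unfolding approx_map_def
  proof (intro exI[of _ P] exI[of _ m] exI[of _ \<pi>] exI[of _ l] conjI ballI)
    fix a b assume ab: "a \<in> A" "b \<in> A"
    show "lipschitz_median_interval P m (\<pi> a) (\<pi> b) (\<lambda>x y. \<rho> (l x) (l y)) K (E p) \<eta>"
    proof unfold_locales
      show "finite P" "\<pi> a \<in> P" "\<pi> b \<in> P" "1 \<le> K" "0 \<le> E p"
        using P(1) \<pi> ab K_ge_1 H_le_E by auto
      show "k \<le> \<eta>" if "cube_embeds k P m" for k
        using cube_embeds_le_rank[OF P(1) that] P(3) by simp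
      show "\<rho> (l x) (l z) \<le> \<rho> (l x) (l y) + \<rho> (l y) (l z)" if "x \<in> P" "y \<in> P" "z \<in> P" for x y z
        using triangle l that by simp
    qed (use l lip in \<open>auto simp: commute\<close>)
  next
    fix a b c assume abc: "a \<in> A" "b \<in> A" "c \<in> A"
    define u where "u = \<mu> (l (\<pi> a)) (l (\<pi> b)) (l (\<pi> c))"
    have X: "u \<in> X" "\<mu> a b c \<in> X" "l (m (\<pi> a) (\<pi> b) (\<pi> c)) \<in> X"
      using abc l \<pi> closed \<mu>_closed assms(1) by (auto simp: u_def subset_iff)
    have "\<rho> (\<mu> a b c) u \<le> K * (\<rho> a (l (\<pi> a)) + \<rho> b (l (\<pi> b)) + \<rho> c (l (\<pi> c))) + H0"
      unfolding u_def using abc l \<pi> assms(1) by (intro \<mu>_lipschitz) auto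
    also have "\<dots> \<le> K * (H p + H p + H p) + H0"
      using l\<pi> abc K_ge_1 by (intro add_mono mult_left_mono) auto
    finally have "\<rho> (\<mu> a b c) u \<le> 3 * K * H p + H0" by simp
    moreover have "\<rho> (l (m (\<pi> a) (\<pi> b) (\<pi> c))) u \<le> H p"
      unfolding u_def using lm \<pi> abc by blast
    ultimately show "\<rho> (l (m (\<pi> a) (\<pi> b) (\<pi> c))) (\<mu> a b c) \<le> E p"
      using triangle[OF X(3,1,2)] commute[of u "\<mu> a b c"] H_nonneg[of p]
      by (simp add: E_def algebra_simps)
  next
    show "\<rho> (l (m x y z)) (\<mu> (l x) (l y) (l z)) \<le> E p" if "x \<in> P" "y \<in> P" "z \<in> P" for x y z
      using lm[OF that] H_le_E(1)[of p] by simp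
  next
    show "\<rho> a (l (\<pi> a)) \<le> E p" if "a \<in> A" for a
      using l\<pi>[OF that] H_le_E(1)[of p] by simp
  qed (use \<pi> l in auto)
qed

lemma \<mu>_approx:
  assumes "\<rho> x (\<mu> a b c) \<le> e" "x \<in> X" "a \<in> X" "b \<in> X" "c \<in> X" "a' \<in> X" "b' \<in> X" "c' \<in> X"
    "\<rho> a a' + \<rho> b b' + \<rho> c c' \<le> e'"
  shows "\<rho> x (\<mu> a' b' c') \<le> e + K * e' + H0"
proof -
  have "\<rho> (\<mu> a b c) (\<mu> a' b' c') \<le> K * (\<rho> a a' + \<rho> b b' + \<rho> c c') + H0"
    using assms by (intro \<mu>_lipschitz) auto
  also have "\<dots> \<le> K * e' + H0" using assms(9) K_ge_1 by simp
  finally show ?thesis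
    using triangle[of x "\<mu> a b c" "\<mu> a' b' c'"] assms(1-8) \<mu>_closed by simp
qed

text \<open>Identities of median algebras on at most four points, valid up to an error controlled by
  \<open>E 4\<close>. The last one holds because the median of \<open>y\<close>, \<open>c\<close>,
  \<open>x\<close> and the point \<open>c\<close> both lie in the convex interval from
  \<open>x\<close> to \<open>c\<close>.\<close>

lemma four_point_errors:
  obtains \<tau> where "0 \<le> \<tau>"
    "\<And>a b c. \<lbrakk>a \<in> X; b \<in> X; c \<in> X\<rbrakk> \<Longrightarrow> \<rho> (\<mu> a b c) (\<mu> a b (\<mu> a b c)) \<le> \<tau>"
    "\<And>a b. \<lbrakk>a \<in> X; b \<in> X\<rbrakk> \<Longrightarrow> \<rho> a (\<mu> a b a) \<le> \<tau>"
    "\<And>x y c h. \<lbrakk>x \<in> X; y \<in> X; c \<in> X; h \<in> X\<rbrakk>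
       \<Longrightarrow> \<rho> (\<mu> (\<mu> y c x) h c) (\<mu> x c (\<mu> (\<mu> y c x) h c)) \<le> \<tau>"
proof -
  define e where "e = E 4"
  \<comment> \<open>\<open>e2\<close> pays for replacing three arguments with error \<open>e\<close>
    each; \<open>e3\<close> repeats this when one argument is already off by
    \<open>e2\<close>.\<close>
  define e2 where "e2 = e + K * (3 * e) + H0"
  define e3 where "e3 = e + K * (2 * e + e2) + H0"
  have e0: "0 \<le> e" using H_le_E by (simp add: e_def)
  have "e \<le> K * (3 * e)" using mult_right_mono[OF K_ge_1, of "3 * e"] e0 by simp
  then have ee: "2 * e \<le> e2" using H0_nonneg by (simp add: e2_def)
  then have "2 * e + e2 \<le> K * (2 * e + e2)" 
    using mult_right_mono[OF K_ge_1, of "2 * e + e2"] e0 by simp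
  then have ee3: "2 * e \<le> e3" "0 \<le> e3" using H0_nonneg e0 ee by (auto simp: e3_def)
  show thesis
  proof (rule that[of "e2 + e3"])
    show "0 \<le> e2 + e3" using ee ee3 e0 by simp
  next
    fix a b c assume X: "a \<in> X" "b \<in> X" "c \<in> X"
    have "card {a, b, c} \<le> 4" using card_insert_le_m1[of 4 "{b, c}" a] card_insert_le_m1[of 3 "{c}" b] by simp
    then obtain P m \<pi> l where "approx_map {a, b, c} e P m \<pi> l"
      using approximation[of "{a, b, c}" 4] X by (auto simp: e_def)
    note ap = approx_mapD[OF this]
    interpret lipschitz_median_interval P m "\<pi> a" "\<pi> b" "\<lambda>x y. \<rho> (l x) (l y)" K e \<eta>
      using ap(1) by simp
    define u where "u = m (\<pi> a) (\<pi> b) (\<pi> c)"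
    have uP: "u \<in> P" using closed ap(2) by (simp add: u_def)
    have "m (\<pi> a) (\<pi> b) u = u" using project_I[of "\<pi> c"] I_abs ap(2) by (simp add: u_def)
    then have "\<rho> (l u) (\<mu> (l (\<pi> a)) (l (\<pi> b)) (l u)) \<le> e" using ap(4)[of "\<pi> a" "\<pi> b" u] ap(2) uP by simp
    moreover have *: "\<rho> (l u) (\<mu> a b c) \<le> e" using ap(6)[of a b c] by (simp add: u_def)
    moreover have "\<rho> (l (\<pi> a)) a \<le> e" "\<rho> (l (\<pi> b)) b \<le> e"
      using ap(5) by (simp_all add: commute)
    ultimately have "\<rho> (l u) (\<mu> a b (\<mu> a b c)) \<le> e + K * (3 * e) + H0"
      using ap(2,3) uP X \<mu>_closed
      by (intro \<mu>_approx[where a = "l (\<pi> a)" and b = "l (\<pi> b)" and c = "l u"]) auto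
    then show "\<rho> (\<mu> a b c) (\<mu> a b (\<mu> a b c)) \<le> e2 + e3"
      using triangle[of "\<mu> a b c" "l u" "\<mu> a b (\<mu> a b c)"] * commute[of "l u" "\<mu> a b c"] X uP ap(3) \<mu>_closed ee3(1) e0
      by (simp add: e2_def)
  next
    fix a b assume X: "a \<in> X" "b \<in> X"
    have "card {a, b} \<le> 4" using card_insert_le_m1[of 4 "{b}" a] by simp
    then obtain P m \<pi> l where "approx_map {a, b} e P m \<pi> l"
      using approximation[of "{a, b}" 4] X by (auto simp: e_def)
    note ap = approx_mapD[OF this]
    interpret lipschitz_median_interval P m "\<pi> a" "\<pi> b" "\<lambda>x y. \<rho> (l x) (l y)" K e \<eta>
      using ap(1) by simp
    have "\<rho> (l (\<pi> a)) (\<mu> a b a) \<le> e"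
      using ap(6)[of a b a] majority'(2)[of "\<pi> a" "\<pi> b"] ap(2) by simp
    then show "\<rho> a (\<mu> a b a) \<le> e2 + e3"
      using triangle[of a "l (\<pi> a)" "\<mu> a b a"] ap(2,3,5) X \<mu>_closed ee ee3 by fastforce
  next
    fix x y c h assume X: "x \<in> X" "y \<in> X" "c \<in> X" "h \<in> X"
    define A where "A = {x, y, c, h}"
    have A: "A \<subseteq> X" "finite A" "A \<noteq> {}" "x \<in> A" "y \<in> A" "c \<in> A" "h \<in> A" using X by (auto simp: A_def)
    have "card A \<le> 4" unfolding A_def
      using card_insert_le_m1[of 4 "{y, c, h}" x] card_insert_le_m1[of 3 "{c, h}" y] card_insert_le_m1[of 2 "{h}" c] by simp
    then obtain P m \<pi> l where "approx_map A e P m \<pi> l"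
      using approximation[OF A(1-3), of 4] by (auto simp: e_def)
    note ap = approx_mapD[OF this]
    interpret lipschitz_median_interval P m "\<pi> x" "\<pi> c" "\<lambda>x y. \<rho> (l x) (l y)" K e \<eta>
      using ap(1) A by simp
    define u where "u = m (\<pi> y) (\<pi> c) (\<pi> x)"
    define v where "v = m u (\<pi> h) (\<pi> c)"
    have P: "\<pi> x \<in> P" "\<pi> y \<in> P" "\<pi> c \<in> P" "\<pi> h \<in> P" using A ap(2) by auto
    then have uvP: "u \<in> P" "v \<in> P" using closed by (auto simp: u_def v_def)
    have "u \<in> I" using project_I[of "\<pi> y"] perm[of "\<pi> x" "\<pi> c" "\<pi> y"] P by (simp add: u_def)
    then have "v \<in> I" using m_I[of u "\<pi> c" "\<pi> h"] b_I perm[of u "\<pi> c" "\<pi> h"] P uvP by (simp add: v_def)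
    then have v: "m (\<pi> x) (\<pi> c) v = v" by (rule I_abs)
    have lX: "l (\<pi> x) \<in> X" "l (\<pi> c) \<in> X" "l (\<pi> h) \<in> X" "l u \<in> X" "l v \<in> X" using P uvP ap(3) by auto
    have l\<pi>: "\<rho> (l (\<pi> x)) x \<le> e" "\<rho> (l (\<pi> c)) c \<le> e" "\<rho> (l (\<pi> h)) h \<le> e" 
      using ap(5) A by (simp_all add: commute)
    have "\<rho> (l u) (\<mu> y c x) \<le> e" using ap(6) A by (simp add: u_def)
    define w where "w = \<mu> (\<mu> y c x) h c"
    have wX: "w \<in> X" using X \<mu>_closed by (simp add: w_def)
    have 1: "\<rho> (l v) w \<le> e2"
      unfolding w_def e2_def
      using ap(4)[of u "\<pi> h" "\<pi> c"] P uvP lX X \<mu>_closed l\<pi> \<open>\<rho> (l u) (\<mu> y c x) \<le> e\<close>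
      by (intro \<mu>_approx[where a = "l u" and b = "l (\<pi> h)" and c = "l (\<pi> c)"]) (auto simp: v_def)
    have 2: "\<rho> (l v) (\<mu> x c w) \<le> e3"
      unfolding e3_def
      using ap(4)[of "\<pi> x" "\<pi> c" v] v P uvP lX X wX l\<pi> 1
      by (intro \<mu>_approx[where a = "l (\<pi> x)" and b = "l (\<pi> c)" and c = "l v"]) auto
    show "\<rho> w (\<mu> x c w) \<le> e2 + e3"
      using triangle[of w "l v" "\<mu> x c w"] 1 2 lX wX X \<mu>_closed commute[of w "l v"] by fastforce
  qed
qed

section \<open>Joins and nets in coarse intervals\<close>

text \<open>Transfer of \<open>join_exists\<close>. The number of points enters only through
  \<open>E\<close>, and the factor in front of \<open>R\<close> is independent of it; hence for a
  fixed number of points the join stays at distance linear in \<open>R\<close>.\<close>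

lemma coarse_join:
  assumes "a \<in> X" "b \<in> X" "S \<subseteq> X" "finite S" "card S \<le> n"
    and S: "\<And>s. s \<in> S \<Longrightarrow> \<rho> a s \<le> R" "\<And>s. s \<in> S \<Longrightarrow> \<rho> s (\<mu> a b s) \<le> \<tau>" and "0 \<le> R" "0 \<le> \<tau>"
  obtains h where "h \<in> X" "\<rho> a h \<le> (\<eta> * K ^ \<eta> + 1) * (R + \<tau> + 4 * E (n + 2))"
    "\<And>s. s \<in> S \<Longrightarrow> \<rho> s (\<mu> a h s) \<le> (1 + K) * (\<tau> + 3 * E (n + 2))"
    "\<And>s. s \<in> S \<Longrightarrow> \<rho> h (\<mu> s h b) \<le> (1 + K) * (\<tau> + 3 * E (n + 2))"
proof -
  define e where "e = E (n + 2)"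
  have e0: "0 \<le> e" "H0 \<le> e" using H_le_E by (simp_all add: e_def)
  define A where "A = insert a (insert b S)"
  have A: "A \<subseteq> X" "finite A" "A \<noteq> {}" "a \<in> A" "b \<in> A" "S \<subseteq> A"
    using assms by (auto simp: A_def)
  have "card A \<le> n + 2"
    unfolding A_def using assms(4,5) card_insert_le_m1[of "n + 2" "insert b S" a] card_insert_le_m1[of "n + 1" S b] by simp
  then obtain P m \<pi> l where "approx_map A e P m \<pi> l"
    using approximation[OF A(1-3), of "n + 2"] by (auto simp: e_def)
  note ap = approx_mapD[OF this]
  interpret lipschitz_median_interval P m "\<pi> a" "\<pi> b" "\<lambda>x y. \<rho> (l x) (l y)" K e \<eta>
    using ap(1) A by simp
  \<comment> \<open>Points that lie in the interval only up to \<open>\<tau>\<close> are projected,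
    so that the finite algebra sees genuine members of \<open>I\<close>.\<close>
  define s' where "s' s = m (\<pi> a) (\<pi> b) (\<pi> s)" for s
  have s'I: "s' s \<in> I" if "s \<in> S" for s using project_I ap(2) A that by (auto simp: s'_def)
  have lX: "l (\<pi> a) \<in> X" "l (\<pi> b) \<in> X" using A ap by auto
  have s': "\<rho> s (l (s' s)) \<le> \<tau> + e" "l (s' s) \<in> X" "s \<in> X" if s: "s \<in> S" for s
  proof -
    show X: "l (s' s) \<in> X" "s \<in> X" using s'I I_P ap(3) assms(3) s by auto
    have "\<rho> (l (s' s)) (\<mu> a b s) \<le> e" using ap(6) A s by (auto simp: s'_def)
    then show "\<rho> s (l (s' s)) \<le> \<tau> + e"
      using triangle[of s "\<mu> a b s" "l (s' s)"] X \<mu>_closed assms(1,2) S(2)[OF s]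
      by (simp add: commute)
  qed
  have "\<rho> (l (\<pi> a)) (l (s' s)) \<le> R + \<tau> + 2 * e" if s: "s \<in> S" for s
    using triangle[of "l (\<pi> a)" a "l (s' s)"] triangle[of a s "l (s' s)"] s'[OF s] S(1)[OF s] ap(5)[OF A(4)]
      lX assms(1) by (simp add: commute)
  then obtain h0 where h0: "h0 \<in> I" "\<rho> (l (\<pi> a)) (l h0) \<le> \<eta> * K ^ \<eta> * (R + \<tau> + 2 * e + e)"
    "\<And>s. s \<in> S \<Longrightarrow> m (\<pi> a) h0 (s' s) = s' s" "\<And>s. s \<in> S \<Longrightarrow> m (s' s) h0 (\<pi> b) = h0"
    using join_exists[of "s' ` S" "R + \<tau> + 2 * e"] s'I e0 assms(8,9)
    by (smt (verit, ccfv_SIG) image_iff image_subsetI)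
  define h where "h = l h0"
  have hP: "h0 \<in> P" and hX: "h \<in> X" using h0(1) I_P ap(3) by (auto simp: h_def)
  have K1: "1 \<le> K" by (rule K_ge_1)
  have "\<rho> a h \<le> e + \<eta> * K ^ \<eta> * (R + \<tau> + 2 * e + e)"
    using triangle[of a "l (\<pi> a)" h] ap(5)[OF A(4)] h0(2) assms(1) lX hX by (simp add: h_def)
  also have "\<eta> * K ^ \<eta> * (R + \<tau> + 2 * e + e) \<le> \<eta> * K ^ \<eta> * (R + \<tau> + 4 * e)"
    using e0 K1 by (intro mult_left_mono) auto
  also have "e + \<eta> * K ^ \<eta> * (R + \<tau> + 4 * e) \<le> (R + \<tau> + 4 * e) + \<eta> * K ^ \<eta> * (R + \<tau> + 4 * e)"
    using e0 assms(8,9) by simp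
  finally have "\<rho> a h \<le> (\<eta> * K ^ \<eta> + 1) * (R + \<tau> + 4 * e)"
    by (simp add: algebra_simps)
  moreover have "\<rho> s (\<mu> a h s) \<le> (1 + K) * (\<tau> + 3 * e)" if s: "s \<in> S" for s
  proof -
    have "\<rho> (l (s' s)) (\<mu> (l (\<pi> a)) h (l (s' s))) \<le> e"
      using ap(4)[of "\<pi> a" h0 "s' s"] h0(3)[OF s] hP s'I[OF s] I_P a_in by (simp add: h_def)
    then have "\<rho> (l (s' s)) (\<mu> a h s) \<le> e + K * (\<tau> + 3 * e) + H0"
      using s'[OF s] ap(5)[OF A(4)] lX hX assms(1) e0
      by (intro \<mu>_approx[where a = "l (\<pi> a)" and b = h and c = "l (s' s)"]) (auto simp: commute)
    then show ?thesis
      using triangle[of s "l (s' s)" "\<mu> a h s"] s'[OF s] assms(1) hX \<mu>_closed e0 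
      by (simp add: algebra_simps)
  qed
  moreover have "\<rho> h (\<mu> s h b) \<le> (1 + K) * (\<tau> + 3 * e)" if s: "s \<in> S" for s
  proof -
    have "\<rho> h (\<mu> (l (s' s)) h (l (\<pi> b))) \<le> e"
      using ap(4)[of "s' s" h0 "\<pi> b"] h0(4)[OF s] hP s'I[OF s] I_P b_in by (simp add: h_def)
    then have "\<rho> h (\<mu> s h b) \<le> e + K * (\<tau> + 3 * e) + H0"
      using s'[OF s] ap(5)[OF A(5)] lX hX assms(2) e0
      by (intro \<mu>_approx[where a = "l (s' s)" and b = h and c = "l (\<pi> b)"]) (auto simp: commute)
    then show ?thesis
      using e0 assms(9) by (simp add: algebra_simps)
  qed
  ultimately show thesis using that[of h] hX by (simp add: e_def)
qed

text \<open>One finite algebra approximates \<open>S\<close> together with a subdivided geodesic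
  from \<open>a\<close> to \<open>h\<close>, and \<open>card_separated_le\<close> counts there. The
  required separation depends on \<open>card S\<close> through \<open>E\<close>, so the lemma is
  applied to sets of prescribed size.\<close>

lemma coarse_card_separated_le:
  assumes "discretely_geodesic X \<rho>" "n > 0" "a \<in> X" "h \<in> X" "S \<subseteq> X" "finite S"
    and S: "\<And>s. s \<in> S \<Longrightarrow> \<rho> s (\<mu> a h s) \<le> \<tau>"
    and sep: "\<And>s t. \<lbrakk>s \<in> S; t \<in> S; s \<noteq> t\<rbrakk> \<Longrightarrow>
      \<rho> s t > 2 * (\<tau> + E (card S + n + 3)) + 2 * \<eta> * K ^ 4 * (\<rho> a h / n + 1 + 6 * E (card S + n + 3))"
  shows "card S \<le> (n + 1) ^ \<eta>"
proof -
  define e where "e = E (card S + n + 3)"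
  have e0: "0 \<le> e" "H0 \<le> e" using H_le_E by (simp_all add: e_def)
  obtain g where g: "\<And>j. g j \<in> X" "g 0 = a" "g n = h" "\<And>j. j < n \<Longrightarrow> \<rho> (g j) (g (Suc j)) \<le> \<rho> a h / n + 1"
    using discretized_geodesic[OF assms(1,3,4,2)] by blast
  define \<theta> where "\<theta> = \<rho> a h / n + 1"
  have \<theta>: "0 \<le> \<theta>" by (simp add: \<theta>_def)
  define A where "A = S \<union> g ` {..n}"
  have A: "A \<subseteq> X" "finite A" "A \<noteq> {}" "a \<in> A" "h \<in> A" "S \<subseteq> A" "\<And>j. j \<le> n \<Longrightarrow> g j \<in> A"
    using assms g by (auto simp: A_def)
  have "card A \<le> card S + card (g ` {..n})" unfolding A_def by (rule card_Un_le)
  also have "card (g ` {..n}) \<le> n + 1" using card_image_le[of "{..n}" g] by simp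
  finally have "card A \<le> card S + n + 3" by simp
  then obtain P m \<pi> l where "approx_map A e P m \<pi> l"
    using approximation[OF A(1-3), of "card S + n + 3"] by (auto simp: e_def)
  note ap = approx_mapD[OF this]
  interpret lipschitz_median_interval P m "\<pi> a" "\<pi> h" "\<lambda>x y. \<rho> (l x) (l y)" K e \<eta>
    using ap(1) A by simp
  define g' where "g' j = \<pi> (g (min j n))" for j
  have g'_step: "\<rho> (l (g' j)) (l (g' (Suc j))) \<le> \<theta> + 2 * e" if "j < n" for j
  proof -
    have "\<rho> (l (\<pi> (g j))) (l (\<pi> (g (Suc j)))) \<le> \<rho> (g j) (l (\<pi> (g j))) + \<rho> (g j) (g (Suc j)) + \<rho> (g (Suc j)) (l (\<pi> (g (Suc j))))"
      using triangle[of "l (\<pi> (g j))" "g j" "l (\<pi> (g (Suc j)))"] triangle[of "g j" "g (Suc j)" "l (\<pi> (g (Suc j)))"]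
        g(1) ap(2,3) A(7) that by (simp add: commute)
    then show ?thesis
      using g(4)[OF that] ap(5)[OF A(7), of j] ap(5)[OF A(7), of "Suc j"] that by (simp add: g'_def \<theta>_def min_def)
  qed
  define s where "s = K * (K * (\<theta> + 2 * e) + e) + e"
  have s0: "0 \<le> s" using K_ge_1 \<theta> e0 by (simp add: s_def)
  obtain w where w: "\<And>j. w j \<in> I" "\<And>j. D (w j) \<subseteq> D (w (Suc j))" "w 0 = \<pi> a" "w n = \<pi> h"
    "\<And>j. j < n \<Longrightarrow> \<rho> (l (w j)) (l (w (Suc j))) \<le> s"
    unfolding s_def using monotone_path[of g' n "\<theta> + 2 * e"] g'_step ap(2) A(7) g(2,3)
    by (auto simp: g'_def)
  define s' where "s' s = m (\<pi> a) (\<pi> h) (\<pi> s)" for s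
  have s'I: "s' s \<in> I" if "s \<in> S" for s using project_I ap(2) A that by (auto simp: s'_def)
  have s': "\<rho> s (l (s' s)) \<le> \<tau> + e" "l (s' s) \<in> X" "s \<in> X" if s: "s \<in> S" for s
  proof -
    show X: "l (s' s) \<in> X" "s \<in> X" using s'I I_P ap(3) assms(5) s by auto
    have "\<rho> (l (s' s)) (\<mu> a h s) \<le> e" using ap(6) A s by (auto simp: s'_def)
    then show "\<rho> s (l (s' s)) \<le> \<tau> + e"
      using triangle[of s "\<mu> a h s" "l (s' s)"] X \<mu>_closed assms(3,4) S(1)[OF s]
      by (simp add: commute)
  qed
  have B: "K * (K * s + e) + e \<le> K ^ 4 * (\<theta> + 6 * e)"
  proof -
    have "K * (K * s + e) + e = K ^ 4 * (\<theta> + 2 * e) + K ^ 3 * e + K ^ 2 * e + K * e + e"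
      by (simp add: s_def algebra_simps power_numeral_reduce)
    moreover have "K ^ 3 * e \<le> K ^ 4 * e" "K ^ 2 * e \<le> K ^ 4 * e" "K ^ 1 * e \<le> K ^ 4 * e" "K ^ 0 * e \<le> K ^ 4 * e"
      using K_ge_1 e0 by (intro mult_right_mono power_increasing; simp)+
    ultimately show ?thesis by (simp add: algebra_simps)
  qed
  \<comment> \<open>Projecting the two points costs \<open>2 * (\<tau> + e)\<close>; the remaining
    separation is what \<open>card_separated_le\<close> asks for.\<close>
  have far: "\<rho> (l (s' x)) (l (s' y)) > 2 * \<eta> * (K * (K * s + e) + e)" if xy: "x \<in> S" "y \<in> S" "x \<noteq> y" for x y
  proof -
    have "\<rho> x y \<le> \<rho> x (l (s' x)) + \<rho> (l (s' x)) (l (s' y)) + \<rho> y (l (s' y))"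
      using triangle[of x "l (s' x)" y] triangle[of "l (s' x)" "l (s' y)" y] s'[OF xy(1)] s'[OF xy(2)]
      by (simp add: commute)
    moreover have "2 * \<eta> * (K * (K * s + e) + e) \<le> 2 * \<eta> * (K ^ 4 * (\<theta> + 6 * e))"
      using B by (intro mult_left_mono) auto
    ultimately show ?thesis
      using sep[OF xy] s'(1)[OF xy(1)] s'(1)[OF xy(2)] by (simp add: e_def \<theta>_def algebra_simps)
  qed
  have "inj_on s' S"
  proof (rule inj_onI, rule ccontr)
    fix x y assume xy: "x \<in> S" "y \<in> S" "s' x = s' y" "x \<noteq> y"
    have "0 \<le> 2 * \<eta> * (K * (K * s + e) + e)" using K_ge_1 e0 s0 by simp
    then show False using far[OF xy(1,2,4)] s'(2)[OF xy(2)] xy(3) by simp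
  qed
  then have "card S = card (s' ` S)" by (simp add: card_image)
  also have "\<dots> \<le> (n + 1) ^ \<eta>"
  proof (rule card_separated_le[of w n s])
    show "\<rho> (l x) (l y) > 2 * \<eta> * (K * (K * s + e) + e)"
      if "x \<in> s' ` S" "y \<in> s' ` S" "x \<noteq> y" for x y
      using that far by blast
  qed (use w s'I s0 in auto)
  finally show ?thesis .
qed

text \<open>The endpoint \<open>b\<close> may be arbitrarily far away. For a hypothetical separated
  set of size \<open>Suc N\<close> it is replaced by a coarse join at distance \<open>O(r)\<close>
  from \<open>a\<close>, so that finitely many subdivisions, independent of \<open>r\<close>, make
  the layers short.\<close>

lemma interval_net:
  assumes "discretely_geodesic X \<rho>" "0 \<le> R0" "0 < \<epsilon>" "0 \<le> \<tau>"
  obtains N :: nat and \<Lambda> :: real where "\<Lambda> \<ge> 1"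
    "\<And>r a b Z. \<lbrakk>r \<ge> \<Lambda>; a \<in> X; b \<in> X; Z \<subseteq> X; \<forall>z\<in>Z. \<rho> a z \<le> R0 * r \<and> \<rho> z (\<mu> a b z) \<le> \<tau>\<rbrakk>
      \<Longrightarrow> \<exists>T\<subseteq>Z. finite T \<and> card T \<le> N \<and> (\<forall>z\<in>Z. \<exists>t\<in>T. \<rho> z t \<le> \<epsilon> * r)"
proof -
  define C where "C = \<eta> * K ^ \<eta> + 1"
  have C: "0 \<le> C" using K_ge_1 by (simp add: C_def)
  \<comment> \<open>Chosen so that the term linear in \<open>r\<close> is at most half of
    \<open>\<epsilon> * r\<close>. It depends on neither \<open>N\<close> nor the errors, so
    \<open>e1\<close> and \<open>e2\<close> can be taken at the size \<open>Suc N\<close> without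
    circularity.\<close>
  define n where "n = nat \<lceil>4 * \<eta> * K ^ 4 * C * R0 / \<epsilon>\<rceil> + 1"
  have "4 * \<eta> * K ^ 4 * C * R0 / \<epsilon> \<le> n" unfolding n_def by linarith
  then have n: "n > 0" "4 * \<eta> * K ^ 4 * C * R0 / n \<le> \<epsilon>"
    using \<open>0 < \<epsilon>\<close> by (auto simp: n_def field_simps)
  define N where "N = (n + 1) ^ \<eta>"
  define e1 where "e1 = E (Suc N + 2)"
  define e2 where "e2 = E (Suc N + n + 3)"
  define \<tau>' where "\<tau>' = (1 + K) * (\<tau> + 3 * e1)"
  have e: "0 \<le> e1" "0 \<le> e2" using H_le_E by (simp_all add: e1_def e2_def)
  define c where "c = 2 * (\<tau>' + e2) + 2 * \<eta> * K ^ 4 * (C * (\<tau> + 4 * e1) + 1 + 6 * e2)"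
  \<comment> \<open>Beyond this scale the constant terms \<open>c\<close> fit into the other half of
    \<open>\<epsilon> * r\<close>.\<close>
  define \<Lambda> where "\<Lambda> = max 1 (2 * c / \<epsilon>)"
  show thesis
  proof (rule that[of \<Lambda> N])
    show "\<Lambda> \<ge> 1" by (simp add: \<Lambda>_def)
    fix r a b Z
    assume r: "r \<ge> \<Lambda>" and ab: "a \<in> X" "b \<in> X" and Z: "Z \<subseteq> X"
      "\<forall>z\<in>Z. \<rho> a z \<le> R0 * r \<and> \<rho> z (\<mu> a b z) \<le> \<tau>"
    have r1: "1 \<le> r" "c \<le> \<epsilon> * r / 2"
      using r \<open>0 < \<epsilon>\<close> by (auto simp: \<Lambda>_def field_simps)
    have "card T \<noteq> Suc N"
      if T: "T \<subseteq> Z" "finite T" "\<And>x y. \<lbrakk>x \<in> T; y \<in> T; x \<noteq> y\<rbrakk> \<Longrightarrow> \<rho> x y > \<epsilon> * r" for T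
    proof
      assume card: "card T = Suc N"
      obtain h where h: "h \<in> X" "\<rho> a h \<le> C * (R0 * r + \<tau> + 4 * e1)" "\<And>s. s \<in> T \<Longrightarrow> \<rho> s (\<mu> a h s) \<le> \<tau>'"
      proof (rule coarse_join[of a b T "Suc N" "R0 * r" \<tau>])
        show "T \<subseteq> X" "\<And>s. s \<in> T \<Longrightarrow> \<rho> a s \<le> R0 * r" "\<And>s. s \<in> T \<Longrightarrow> \<rho> s (\<mu> a b s) \<le> \<tau>"
          using T(1) Z by auto
        show "0 \<le> R0 * r" using assms(2) r1 by simp
      qed (use ab T(2) card assms(4) in \<open>auto simp: C_def e1_def \<tau>'_def\<close>)
      have "2 * (\<tau>' + e2) + 2 * \<eta> * K ^ 4 * (\<rho> a h / n + 1 + 6 * e2) \<le> \<epsilon> * r"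
      proof -
        have "\<rho> a h / n \<le> C * (R0 * r + \<tau> + 4 * e1) / n"
          using h(2) by (simp add: divide_right_mono)
        also have "\<dots> = C * R0 * r / n + C * (\<tau> + 4 * e1) / n"
          by (simp add: add_divide_distrib algebra_simps)
        also have "C * (\<tau> + 4 * e1) / n \<le> C * (\<tau> + 4 * e1)"
          using frac_le[of "C * (\<tau> + 4 * e1)" "C * (\<tau> + 4 * e1)" 1 n] C e assms(4) n(1) by simp
        finally have "2 * \<eta> * K ^ 4 * (\<rho> a h / n + 1 + 6 * e2)
            \<le> 2 * \<eta> * K ^ 4 * (C * R0 * r / n + (C * (\<tau> + 4 * e1) + 1 + 6 * e2))"
          using K_ge_1 by (intro mult_left_mono) auto
        also have "\<dots> = (4 * \<eta> * K ^ 4 * C * R0 / n) * (r / 2) + (c - 2 * (\<tau>' + e2))"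
          unfolding c_def distrib_left[of "2 * \<eta> * K ^ 4" "C * R0 * r / n"] by simp
        also have "(4 * \<eta> * K ^ 4 * C * R0 / n) * (r / 2) \<le> \<epsilon> * (r / 2)"
          using n(2) r1 by (intro mult_right_mono) auto
        finally show ?thesis using r1(2) by simp
      qed
      then have le: "2 * (\<tau>' + E (Suc N + n + 3)) + 2 * \<eta> * K ^ 4 * (\<rho> a h / n + 1 + 6 * E (Suc N + n + 3)) \<le> \<epsilon> * r"
        by (simp only: e2_def)
      have "card T \<le> (n + 1) ^ \<eta>"
      proof (intro coarse_card_separated_le[of n a h T \<tau>', OF assms(1)])
        fix s t assume "s \<in> T" "t \<in> T" "s \<noteq> t"
        from T(3)[OF this] show "\<rho> s t > 2 * (\<tau>' + E (card T + n + 3))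
            + 2 * \<eta> * K ^ 4 * (\<rho> a h / n + 1 + 6 * E (card T + n + 3))"
          using le unfolding card by linarith
      qed (use T(1,2) h(1,3) Z(1) ab n(1) in auto)
      then show False using card by (simp add: N_def)
    qed
    then obtain T where "T \<subseteq> Z" "finite T" "card T \<le> N" "\<And>z. z \<in> Z \<Longrightarrow> \<exists>t\<in>T. \<rho> z t \<le> max (\<epsilon> * r) 0"
      using exists_net[OF Z(1)] by blast
    moreover have "max (\<epsilon> * r) 0 = \<epsilon> * r" using r1 \<open>0 < \<epsilon>\<close> by simp
    ultimately show "\<exists>T\<subseteq>Z. finite T \<and> card T \<le> N \<and> (\<forall>z\<in>Z. \<exists>t\<in>T. \<rho> z t \<le> \<epsilon> * r)" by auto
  qed
qed

end

section \<open>The compressing map\<close>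

context finite_rank_coarse_median
begin

text \<open>Fix a base point \<open>c\<close> and send \<open>y\<close> to the join of the points of \<open>[y, c]\<close> within distance
  about \<open>r\<close> of \<open>y\<close>. If \<open>y\<close> is \<open>r\<close>-close to \<open>x\<close>, this join lies above \<open>\<mu> y c x \<in> [x, c]\<close>, hence near
  \<open>[x, c]\<close>, and the part of \<open>[x, c]\<close> within distance \<open>O(r)\<close> of \<open>x\<close> has small nets.\<close>

lemma exists_compressing_map:
  assumes "discretely_geodesic X \<rho>" "X \<noteq> {}" "0 < \<epsilon>"
  obtains N :: nat and \<Lambda> :: real where "\<Lambda> \<ge> 1"
    "\<And>r. r \<ge> \<Lambda> \<Longrightarrow> \<exists>h\<in>X \<rightarrow> X. (\<exists>C. \<forall>y\<in>X. \<rho> y (h y) \<le> C) \<and>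
       (\<forall>x\<in>X. \<exists>T\<subseteq>X. finite T \<and> card T \<le> N \<and> (\<forall>y\<in>X. \<rho> x y \<le> r \<longrightarrow> (\<exists>t\<in>T. \<rho> t (h y) \<le> \<epsilon> * r)))"
proof -
  obtain c where c: "c \<in> X" using assms(2) by blast
  obtain \<tau> where \<tau>: "0 \<le> \<tau>"
    "\<And>a b z. \<lbrakk>a \<in> X; b \<in> X; z \<in> X\<rbrakk> \<Longrightarrow> \<rho> (\<mu> a b z) (\<mu> a b (\<mu> a b z)) \<le> \<tau>"
    "\<And>a b. \<lbrakk>a \<in> X; b \<in> X\<rbrakk> \<Longrightarrow> \<rho> a (\<mu> a b a) \<le> \<tau>"
    "\<And>x y c h. \<lbrakk>x \<in> X; y \<in> X; c \<in> X; h \<in> X\<rbrakk>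
       \<Longrightarrow> \<rho> (\<mu> (\<mu> y c x) h c) (\<mu> x c (\<mu> (\<mu> y c x) h c)) \<le> \<tau>"
    using four_point_errors by blast
  have K: "1 \<le> K" by (rule K_ge_1)
  \<comment> \<open>The mesh of the first net is amplified by \<open>K\<close> and then by
    \<open>1 + K\<close> on its way into \<open>s_near\<close>; this choice leaves a quarter of
    \<open>\<epsilon> * r\<close>, and \<open>\<Lambda>\<close> makes the constants \<open>k\<close>
    at most another quarter.\<close>
  define \<epsilon>' where "\<epsilon>' = \<epsilon> / (4 * K * (1 + K))"
  have \<epsilon>': "0 < \<epsilon>'" "(1 + K) * (K * \<epsilon>') = \<epsilon> / 4"
  proof -
    have pos: "0 < 4 * K * (1 + K)" using K by simp
    then show "0 < \<epsilon>'" using assms(3) by (simp add: \<epsilon>'_def)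
    have "\<epsilon>' * (4 * K * (1 + K)) = \<epsilon>" unfolding \<epsilon>'_def using K by auto
    then show "(1 + K) * (K * \<epsilon>') = \<epsilon> / 4" by (simp add: algebra_simps)
  qed
  have K1: "0 \<le> K + 1" using K by simp
  obtain N1 :: nat and \<Lambda>1 :: real where net1: "\<Lambda>1 \<ge> 1"
    "\<And>r a b Z. \<lbrakk>r \<ge> \<Lambda>1; a \<in> X; b \<in> X; Z \<subseteq> X; \<forall>z\<in>Z. \<rho> a z \<le> (K + 1) * r \<and> \<rho> z (\<mu> a b z) \<le> \<tau>\<rbrakk>
      \<Longrightarrow> \<exists>T\<subseteq>Z. finite T \<and> card T \<le> N1 \<and> (\<forall>z\<in>Z. \<exists>t\<in>T. \<rho> z t \<le> \<epsilon>' * r)"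
    by (rule interval_net[OF assms(1) K1 \<epsilon>'(1) \<tau>(1)]) (rule that)
  define e where "e = E (N1 + 2)"
  have e: "0 \<le> e" using H_le_E by (simp add: e_def)
  define C where "C = \<eta> * K ^ \<eta> + 1"
  have C: "0 \<le> C" using K by (simp add: C_def)
  define \<sigma> where "\<sigma> = (1 + K) * (\<tau> + 3 * e)"
  have \<sigma>: "0 \<le> \<sigma>" using K \<tau>(1) e by (simp add: \<sigma>_def)
  define k where "k = (1 + K) * (\<sigma> + H0) + \<tau> + H0"
  have k: "0 \<le> k" using K \<tau>(1) \<sigma> H0_nonneg by (simp add: k_def)
  \<comment> \<open>Coefficient of the distance from \<open>x\<close> to a projected join: at most
    \<open>r\<close> to \<open>y\<close>, then the displacement of \<open>h\<close>, then the error
    of \<open>s_near\<close>.\<close>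
  define R where "R = 1 + C * (K + 2) + \<epsilon>"
  have R: "0 \<le> R" using C K assms(3) by (simp add: R_def)
  have half: "0 < \<epsilon> / 2" using assms(3) by simp
  obtain N2 :: nat and \<Lambda>2 :: real where net2: "\<Lambda>2 \<ge> 1"
    "\<And>r a b Z. \<lbrakk>r \<ge> \<Lambda>2; a \<in> X; b \<in> X; Z \<subseteq> X; \<forall>z\<in>Z. \<rho> a z \<le> R * r \<and> \<rho> z (\<mu> a b z) \<le> \<tau>\<rbrakk>
      \<Longrightarrow> \<exists>T\<subseteq>Z. finite T \<and> card T \<le> N2 \<and> (\<forall>z\<in>Z. \<exists>t\<in>T. \<rho> z t \<le> \<epsilon> / 2 * r)"
    by (rule interval_net[OF assms(1) R half \<tau>(1)]) (rule that)
  define \<Lambda> where "\<Lambda> = Max {\<Lambda>1, \<Lambda>2, H0 + \<tau>, \<tau> + 4 * e, 4 * k / \<epsilon>}"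
  show thesis
  proof (rule that[of \<Lambda> N2])
    show "\<Lambda> \<ge> 1" using net1(1) by (simp add: \<Lambda>_def le_max_iff_disj)
    fix r assume "r \<ge> \<Lambda>"
    then have r: "r \<ge> \<Lambda>1" "r \<ge> \<Lambda>2" "H0 + \<tau> \<le> r" "\<tau> + 4 * e \<le> r" "k \<le> \<epsilon> * r / 4" "0 \<le> r"
      using assms(3) net1(1) by (auto simp: \<Lambda>_def field_simps)
    have "\<exists>h\<in>X. \<rho> y h \<le> C * (K + 2) * r \<and>
        (\<forall>x\<in>X. \<rho> x y \<le> r \<longrightarrow> \<rho> h (\<mu> (\<mu> y c x) h c) \<le> \<sigma> + K * (\<epsilon>' * r) + H0)" if y: "y \<in> X" for y
    proof -
      define Z where "Z = {\<mu> y c x | x. x \<in> X \<and> \<rho> x y \<le> r}"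
      have ZX: "Z \<subseteq> X" using \<mu>_closed c y by (auto simp: Z_def)
      have Zr: "\<rho> y z \<le> (K + 1) * r" if z: "z \<in> Z" for z
      proof -
        obtain x where x: "x \<in> X" "\<rho> x y \<le> r" "z = \<mu> y c x" using z by (auto simp: Z_def)
        have "\<rho> y (\<mu> y c x) \<le> \<tau> + K * r + H0"
          using x y c \<tau>(3) by (intro \<mu>_approx[where a = y and b = c and c = y]) (auto simp: commute)
        then show ?thesis using x(3) r(3) by (simp add: algebra_simps)
      qed
      have Z\<tau>: "\<rho> z (\<mu> y c z) \<le> \<tau>" if "z \<in> Z" for z
        using that \<tau>(2) y c by (auto simp: Z_def)
      \<comment> \<open>The join is taken over a net of \<open>Z\<close>, not over \<open>Z\<close>
        itself: its size is at most \<open>N1\<close>, so the errors do not grow with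
        \<open>r\<close>.\<close>
      obtain T where T: "T \<subseteq> Z" "finite T" "card T \<le> N1" "\<And>z. z \<in> Z \<Longrightarrow> \<exists>t\<in>T. \<rho> z t \<le> \<epsilon>' * r"
        using net1(2)[OF r(1) y c ZX] Zr Z\<tau> by blast
      have TX: "T \<subseteq> X" using T(1) ZX by blast
      have "0 \<le> (K + 1) * r" using K r(6) by simp
      obtain h where h: "h \<in> X" "\<rho> y h \<le> C * ((K + 1) * r + \<tau> + 4 * e)" "\<And>t. t \<in> T \<Longrightarrow> \<rho> h (\<mu> t h c) \<le> \<sigma>"
      proof (rule coarse_join[OF y c TX T(2,3) _ _ \<open>0 \<le> (K + 1) * r\<close> \<tau>(1)])
        show "\<rho> y s \<le> (K + 1) * r" "\<rho> s (\<mu> y c s) \<le> \<tau>" if "s \<in> T" for s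
          using that T(1) Zr Z\<tau> by auto
      qed (auto simp: C_def e_def \<sigma>_def)
      have "C * ((K + 1) * r + \<tau> + 4 * e) \<le> C * ((K + 2) * r)"
        using C r(4) by (intro mult_left_mono) (auto simp: algebra_simps)
      then have "\<rho> y h \<le> C * (K + 2) * r" using h(2) by simp
      moreover have "\<rho> h (\<mu> (\<mu> y c x) h c) \<le> \<sigma> + K * (\<epsilon>' * r) + H0" if x: "x \<in> X" "\<rho> x y \<le> r" for x
      proof -
        have m: "\<mu> y c x \<in> Z" using x by (auto simp: Z_def)
        then obtain t where t: "t \<in> T" "\<rho> (\<mu> y c x) t \<le> \<epsilon>' * r" using T(4) by blast
        then show ?thesis
          using h(1) h(3)[OF t(1)] TX ZX m c
          by (intro \<mu>_approx[where a = t and b = h and c = c]) (auto simp: commute)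
      qed
      ultimately show ?thesis using h(1) by blast
    qed
    then obtain h where hX: "\<And>y. y \<in> X \<Longrightarrow> h y \<in> X"
      and h_near: "\<And>y. y \<in> X \<Longrightarrow> \<rho> y (h y) \<le> C * (K + 2) * r"
      and h_above: "\<And>x y. \<lbrakk>x \<in> X; y \<in> X; \<rho> x y \<le> r\<rbrakk> \<Longrightarrow> \<rho> (h y) (\<mu> (\<mu> y c x) (h y) c) \<le> \<sigma> + K * (\<epsilon>' * r) + H0"
      by metis
    \<comment> \<open>\<open>h y\<close> is close to its median \<open>w\<close> with
      \<open>\<mu> y c x\<close> and \<open>c\<close>, and \<open>w\<close> lies coarsely in the
      interval from \<open>x\<close> to \<open>c\<close> by the four-point estimate.\<close>
    have s_near: "\<rho> (h y) (\<mu> x c (h y)) \<le> \<epsilon> * r / 2" if xy: "x \<in> X" "y \<in> X" "\<rho> x y \<le> r" for x y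
    proof -
      define w where "w = \<mu> (\<mu> y c x) (h y) c"
      define A where "A = \<sigma> + K * (\<epsilon>' * r) + H0"
      have wX: "w \<in> X" using xy c hX \<mu>_closed by (simp add: w_def)
      have hw: "\<rho> (h y) w \<le> A" using h_above[OF xy] by (simp add: w_def A_def)
      have "\<rho> w (\<mu> x c w) \<le> \<tau>" using \<tau>(4)[of x y c "h y"] xy c hX by (simp add: w_def)
      then have "\<rho> w (\<mu> x c (h y)) \<le> \<tau> + K * A + H0"
        using hw xy c hX wX by (intro \<mu>_approx[where a = x and b = c and c = w]) (auto simp: commute)
      then have "\<rho> (h y) (\<mu> x c (h y)) \<le> A + (\<tau> + K * A + H0)"
        using triangle[of "h y" w "\<mu> x c (h y)"] hw xy c hX wX \<mu>_closed by simp
      also have "\<dots> = k + (1 + K) * (K * \<epsilon>') * r"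
        by (simp add: A_def k_def algebra_simps)
      also have "\<dots> \<le> \<epsilon> * r / 2"
        unfolding \<epsilon>'(2) using r(5) by simp
      finally show ?thesis .
    qed
    have "\<exists>T\<subseteq>X. finite T \<and> card T \<le> N2 \<and> (\<forall>y\<in>X. \<rho> x y \<le> r \<longrightarrow> (\<exists>t\<in>T. \<rho> t (h y) \<le> \<epsilon> * r))"
      if x: "x \<in> X" for x
    proof -
      \<comment> \<open>Only the projections of the joins lie in the interval as
        \<open>interval_net\<close> requires; projecting and the second net each use half of
        \<open>\<epsilon> * r\<close>.\<close>
      define Z where "Z = {\<mu> x c (h y) | y. y \<in> X \<and> \<rho> x y \<le> r}"
      have ZX: "Z \<subseteq> X" using \<mu>_closed c x hX by (auto simp: Z_def)
      have Zr: "\<rho> x z \<le> R * r" if z: "z \<in> Z" for z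
      proof -
        obtain y where y: "y \<in> X" "\<rho> x y \<le> r" "z = \<mu> x c (h y)" using z by (auto simp: Z_def)
        have "\<rho> x z \<le> \<rho> x y + \<rho> y (h y) + \<rho> (h y) z"
          using triangle[of x y z] triangle[of y "h y" z] x y hX ZX z by force
        also have "\<dots> \<le> r + C * (K + 2) * r + \<epsilon> * r / 2"
          using y h_near[OF y(1)] s_near[OF x y(1,2)] by simp
        also have "\<dots> \<le> R * r"
          using assms(3) r(6) by (simp add: R_def algebra_simps)
        finally show ?thesis .
      qed
      have Z\<tau>: "\<rho> z (\<mu> x c z) \<le> \<tau>" if "z \<in> Z" for z
        using that \<tau>(2) x c hX by (auto simp: Z_def)
      obtain T where T: "T \<subseteq> Z" "finite T" "card T \<le> N2" "\<And>z. z \<in> Z \<Longrightarrow> \<exists>t\<in>T. \<rho> z t \<le> \<epsilon> / 2 * r"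
        using net2(2)[OF r(2) x c ZX] Zr Z\<tau> by blast
      have "\<exists>t\<in>T. \<rho> t (h y) \<le> \<epsilon> * r" if y: "y \<in> X" "\<rho> x y \<le> r" for y
      proof -
        have z: "\<mu> x c (h y) \<in> Z" using y by (auto simp: Z_def)
        then obtain t where t: "t \<in> T" "\<rho> (\<mu> x c (h y)) t \<le> \<epsilon> / 2 * r" using T(4) by blast
        moreover have "\<rho> (h y) t \<le> \<rho> (h y) (\<mu> x c (h y)) + \<rho> (\<mu> x c (h y)) t"
          using triangle z t(1) T(1) ZX hX[OF y(1)] by blast
        ultimately show ?thesis
          using s_near[OF x y] by (intro bexI[of _ t]) (auto simp: commute)
      qed
      then show ?thesis using T(1-3) ZX by (intro exI[of _ T]) auto
    qed
    then show "\<exists>h\<in>X \<rightarrow> X. (\<exists>C. \<forall>y\<in>X. \<rho> y (h y) \<le> C) \<and>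
       (\<forall>x\<in>X. \<exists>T\<subseteq>X. finite T \<and> card T \<le> N2 \<and> (\<forall>y\<in>X. \<rho> x y \<le> r \<longrightarrow> (\<exists>t\<in>T. \<rho> t (h y) \<le> \<epsilon> * r)))"
      using hX h_near by (intro bexI[of _ h]) blast+
  qed
qed

end

section \<open>Asymptotic dimension growth\<close>

text \<open>Cover by the \<open>r'\<close>-neighbourhoods of the fibres of \<open>h\<close>. The
  members containing \<open>x\<close> correspond to values of \<open>h\<close> on the ball of radius
  \<open>r'\<close>, and \<open>r' > r\<close> gives the strict inequality for the Lebesgue
  number.\<close>

lemma (in Metric_space) asdim_fun_le:
  assumes "0 < r" "r < r'" "M \<noteq> {}" "h \<in> M \<rightarrow> M" and C: "\<And>y. y \<in> M \<Longrightarrow> d y (h y) \<le> C"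
    and n: "\<And>x. x \<in> M \<Longrightarrow> finite (h ` mcball x r') \<and> card (h ` mcball x r') \<le> n"
  shows "asdim_fun M d r \<le> ereal (real n)"
proof -
  define U where "U z = {x \<in> M. \<exists>y\<in>M. d x y \<le> r' \<and> h y = z}" for z
  define \<U> where "\<U> = U ` h ` M"
  have "\<Union>\<U> = M"
  proof
    show "M \<subseteq> \<Union>\<U>"
    proof
      fix y assume y: "y \<in> M"
      then have "y \<in> U (h y)" using assms(1,2) unfolding U_def by force
      then show "y \<in> \<Union>\<U>" using y by (auto simp: \<U>_def)
    qed
  qed (auto simp: \<U>_def U_def)
  moreover have "uniformly_bounded d \<U>"
  proof -
    have "ediam d V \<le> ennreal (2 * r' + 2 * C)" if "V \<in> \<U>" for V
      unfolding ediam_def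
    proof (intro SUP_least ennreal_leI)
      fix u v assume "u \<in> V" "v \<in> V"
      then obtain y y' where y: "u \<in> M" "v \<in> M" "y \<in> M" "y' \<in> M" "d u y \<le> r'" "d v y' \<le> r'" "h y = h y'"
        using \<open>V \<in> \<U>\<close> by (auto simp: \<U>_def U_def)
      have "h y \<in> M" using assms(4) y by blast
      have "d u v \<le> d u y + d y (h y) + (d y' (h y) + d v y')"
        using triangle[of u y v] triangle[of y "h y" v] triangle[of "h y" y' v] y \<open>h y \<in> M\<close>
        by (simp add: commute)
      also have "\<dots> \<le> r' + C + (C + r')"
        using C[OF y(3)] C[OF y(4)] y(5-7) by simp
      finally show "d u v \<le> 2 * r' + 2 * C" by simp
    qed
    then have "(SUP V\<in>\<U>. ediam d V) \<le> ennreal (2 * r' + 2 * C)" by (rule SUP_least)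
    then show ?thesis
      unfolding uniformly_bounded_def using ennreal_less_top le_less_trans by (metis infinity_ennreal_def)
  qed
  moreover have "sup_lebesgue_number M d \<U> > ereal r"
  proof -
    have "lebesgue_number M d \<U> r'"
      unfolding lebesgue_number_def
    proof (intro conjI allI impI)
      show "0 < r'" using assms(1,2) by simp
      fix S assume S: "S \<subseteq> M" "ediam d S \<le> ennreal r'"
      \<comment> \<open>An empty \<open>S\<close> also has to lie in some member, so
        \<open>s\<close> is then any point of \<open>M\<close>.\<close>
      obtain s where s: "s \<in> M" "S = {} \<or> s \<in> S" using assms(3) S(1) by blast
      have "S \<subseteq> U (h s)"
      proof
        fix x assume x: "x \<in> S"
        then have "ennreal (d x s) \<le> ediam d S"
          unfolding ediam_def using s(2) by (intro SUP_upper2[of x] SUP_upper2[of s]) auto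
        then have "d x s \<le> r'"
          using S(2) assms(1,2) by (metis ennreal_le_iff less_imp_le less_trans order_trans)
        then show "x \<in> U (h s)" using x S(1) s(1) by (auto simp: U_def)
      qed
      then show "\<exists>V\<in>\<U>. S \<subseteq> V" using s(1) by (auto simp: \<U>_def)
    qed
    then have "ereal r' \<le> sup_lebesgue_number M d \<U>"
      unfolding sup_lebesgue_number_def by (intro SUP_upper) simp
    then show ?thesis using assms(2) by (metis ereal_less_eq(3) less_ereal.simps(1) less_le_trans)
  qed
  ultimately have "(INF \<U>\<in>{\<U>. \<Union>\<U> = M \<and> uniformly_bounded d \<U> \<and> sup_lebesgue_number M d \<U> > ereal r}.
      multiplicity_cover \<U>) \<le> multiplicity_cover \<U>"
    by (intro INF_lower) simp
  also have "multiplicity_cover \<U> \<le> enat n"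
    unfolding multiplicity_cover_def
  proof (rule Sup_least, clarify)
    fix F x assume F: "F \<subseteq> \<U>" "finite F" "F \<noteq> {}" and "\<Inter>F \<noteq> {}"
    then obtain x where x: "\<And>V. V \<in> F \<Longrightarrow> x \<in> V" by blast
    have "x \<in> M" using x F(1,3) by (auto simp: \<U>_def U_def)
    have "F \<subseteq> U ` (h ` mcball x r')"
    proof
      fix V assume V: "V \<in> F"
      then obtain z where "V = U z" using F(1) by (auto simp: \<U>_def)
      then show "V \<in> U ` (h ` mcball x r')"
        using x[OF V] by (auto simp: U_def)
    qed
    then have "card F \<le> card (h ` mcball x r')"
      using n[OF \<open>x \<in> M\<close>] by (meson surj_card_le)
    then show "enat (card F) \<le> enat n" using n[OF \<open>x \<in> M\<close>] by simp
  qed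
  finally have "ereal_of_enat (INF \<U>\<in>{\<U>. \<Union>\<U> = M \<and> uniformly_bounded d \<U> \<and> sup_lebesgue_number M d \<U> > ereal r}.
      multiplicity_cover \<U>) \<le> ereal_of_enat (enat n)"
    by (simp only: ereal_of_enat_le_iff)
  moreover have "a - 1 \<le> ereal (real n)" if "a \<le> ereal_of_enat (enat n)" for a
    using that by (cases a) (auto simp: one_ereal_def)
  ultimately show ?thesis
    unfolding asdim_fun_def by blast
qed

text \<open>The cover \<open>{{}}\<close> has every positive Lebesgue number, while its only
  nonempty subfamily has empty intersection; the supremum defining the multiplicity is over the
  empty set and equals \<open>0\<close>.\<close>

lemma asdim_fun_empty: "asdim_fun {} \<rho> r \<le> 0"
proof -
  have "\<exists>\<U>. \<Union>\<U> = {} \<and> uniformly_bounded \<rho> \<U> \<and> sup_lebesgue_number {} \<rho> \<U> > ereal r \<and> multiplicity_cover \<U> = 0"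
  proof (intro exI[of _ "{{}}"] conjI)
    have "lebesgue_number {} \<rho> {{}} (max r 0 + 1)"
      by (auto simp: lebesgue_number_def)
    then have "ereal (max r 0 + 1) \<le> sup_lebesgue_number {} \<rho> {{}}"
      unfolding sup_lebesgue_number_def by (intro SUP_upper) simp
    moreover have "ereal r < ereal (max r 0 + 1)" by simp
    ultimately show "sup_lebesgue_number {} \<rho> {{}} > ereal r" by (rule less_le_trans[rotated])
    have "{enat (card F) |F. F \<subseteq> {{} :: 'a set} \<and> finite F \<and> F \<noteq> {} \<and> \<Inter>F \<noteq> {}} = {}"
      by (auto simp: subset_singleton_iff)
    then show "multiplicity_cover {{} :: 'a set} = 0"
      unfolding multiplicity_cover_def by (simp add: Sup_enat_def)
  qed (auto simp: uniformly_bounded_def ediam_def bot_ennreal)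
  then have "(INF \<U>\<in>{\<U>. \<Union>\<U> = {} \<and> uniformly_bounded \<rho> \<U> \<and> sup_lebesgue_number {} \<rho> \<U> > ereal r}.
      multiplicity_cover \<U>) \<le> 0"
    by (metis (mono_tags, lifting) INF_lower mem_Collect_eq)
  then show ?thesis
    unfolding asdim_fun_def by simp
qed

lemma asdim_fun_mono:
  assumes "r \<le> r'"
  shows "asdim_fun X \<rho> r \<le> asdim_fun X \<rho> r'"
  unfolding asdim_fun_def
proof (intro ereal_minus_mono order_refl)
  have "ereal r \<le> ereal r'" using assms by simp
  then show "ereal_of_enat (INF \<U>\<in>{\<U>. \<Union>\<U> = X \<and> uniformly_bounded \<rho> \<U> \<and> sup_lebesgue_number X \<rho> \<U> > ereal r}. multiplicity_cover \<U>)
    \<le> ereal_of_enat (INF \<U>\<in>{\<U>. \<Union>\<U> = X \<and> uniformly_bounded \<rho> \<U> \<and> sup_lebesgue_number X \<rho> \<U> > ereal r'}. multiplicity_cover \<U>)"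
    by (simp only: ereal_of_enat_le_iff) (intro INF_superset_mono, auto intro: le_less_trans[of "ereal r" "ereal r'"])
qed

lemma subexponential_asdim_growthI:
  assumes "\<And>c. c > 1 \<Longrightarrow> \<forall>\<^sub>F r in at_top. asdim_fun X \<rho> r \<le> ereal (c powr r)"
  shows "subexponential_asdim_growth X \<rho>"
proof -
  \<comment> \<open>\<open>real_of_ereal\<close> sends infinite values to \<open>0\<close>, so
    \<open>f\<close> dominates the asymptotic dimension function only from \<open>r0\<close> on;
    \<open>k\<close> is taken at least \<open>r0\<close>.\<close>
  define f where "f r = max 0 (real_of_ereal (asdim_fun X \<rho> r))" for r
  have "\<forall>\<^sub>F r in at_top. f r \<le> c powr r" if "c > 1" for c
    using assms[OF that]
  proof eventually_elim
    case (elim r)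
    then show ?case
      unfolding f_def by (cases "asdim_fun X \<rho> r") auto
  qed
  then have "subexponential f" by (simp add: subexponential_def)
  moreover obtain r0 where r0: "\<And>r. r \<ge> r0 \<Longrightarrow> asdim_fun X \<rho> r \<le> ereal (2 powr r)"
    using assms[of 2] by (auto simp: eventually_at_top_linorder)
  define k where "k = nat \<lceil>max r0 1\<rceil>"
  have k: "real k \<ge> r0" "real k \<ge> 1" unfolding k_def by linarith+
  have "asdim_fun X \<rho> x \<le> ereal (real k) * ereal (f (real k * x + real k)) + ereal (real k)" if "x > real k" for x
  proof -
    define y where "y = real k * x + real k"
    have "1 * x \<le> real k * x" using k(2) that by (intro mult_right_mono) auto
    then have y: "x \<le> y" "r0 \<le> y" unfolding y_def using k that by linarith+
    have "asdim_fun X \<rho> x \<le> asdim_fun X \<rho> y" using asdim_fun_mono[OF y(1)] .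
    also have "\<dots> \<le> ereal (f y)"
      using r0[OF y(2)] unfolding f_def by (cases "asdim_fun X \<rho> y") auto
    also have "f y \<le> real k * f y + real k"
    proof -
      have "1 * f y \<le> real k * f y" using k(2) by (intro mult_right_mono) (auto simp: f_def)
      then show ?thesis by simp
    qed
    finally show ?thesis by (simp add: y_def)
  qed
  ultimately show ?thesis
    unfolding subexponential_asdim_growth_def growth_le_def
    by (intro exI[of _ f] conjI exI[of _ k]) (auto simp: f_def)
qed

theorem theorem1p2:
  fixes X :: "'a set" and \<rho> :: "'a \<Rightarrow> 'a \<Rightarrow> real" and \<mu> :: "'a \<Rightarrow> 'a \<Rightarrow> 'a \<Rightarrow> 'a"
  assumes "coarse_median_space X \<rho> \<mu>"
    and "discretely_geodesic X \<rho>"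
    and "finite_rank X \<rho> \<mu>"
    and "at_most_exponential_growth X \<rho>"
  shows "subexponential_asdim_growth X \<rho>"
proof (rule subexponential_asdim_growthI)
  fix q :: real assume q: "q > 1"
  show "\<forall>\<^sub>F r in at_top. asdim_fun X \<rho> r \<le> ereal (q powr r)"
  proof (cases "X = {}")
    case True
    have "asdim_fun {} \<rho> r \<le> ereal (q powr r)" for r
      using order_trans[OF asdim_fun_empty, of "ereal (q powr r)"] by simp
    then show ?thesis using True by simp
  next
    case False
    interpret coarse_median_space X \<rho> \<mu> by (rule assms(1))
    obtain K H0 where KH: "K > 0" "H0 > 0" "\<And>a b c a' b' c'. \<lbrakk>a \<in> X; b \<in> X; c \<in> X; a' \<in> X; b' \<in> X; c' \<in> X\<rbrakk>
        \<Longrightarrow> \<rho> (\<mu> a b c) (\<mu> a' b' c') \<le> K * (\<rho> a a' + \<rho> b b' + \<rho> c c') + H0"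
      using C1 by metis
    obtain \<eta> H where H: "\<And>p. 0 \<le> (H p :: real)"
      "\<And>p A. \<lbrakk>A \<subseteq> X; finite A; 1 \<le> card A; card A \<le> p\<rbrakk> \<Longrightarrow> (\<exists>(P :: nat set) m. finite P \<and> median_algebra P m \<and>
          median_rank P m \<le> \<eta> \<and> approximates X \<rho> \<mu> (H p) A P m)"
      using assms(3) unfolding finite_rank_def rank_at_most_def by metis
    interpret finite_rank_coarse_median X \<rho> \<mu> "max K 1" H0 H \<eta>
    proof unfold_locales
      fix a b c a' b' c' assume *: "a \<in> X" "b \<in> X" "c \<in> X" "a' \<in> X" "b' \<in> X" "c' \<in> X"
      have "K * (\<rho> a a' + \<rho> b b' + \<rho> c c') \<le> max K 1 * (\<rho> a a' + \<rho> b b' + \<rho> c c')"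
        by (intro mult_right_mono) auto
      then show "\<rho> (\<mu> a b c) (\<mu> a' b' c') \<le> max K 1 * (\<rho> a a' + \<rho> b b' + \<rho> c c') + H0"
        using KH(3)[OF *] by linarith
    qed (use KH(2) H \<mu>_closed in auto)
    obtain c c' where c: "c \<ge> 1" "c' \<ge> 1" "\<And>x r. \<lbrakk>x \<in> X; r > 0\<rbrakk> \<Longrightarrow> finite (mcball x r) \<and> real (card (mcball x r)) \<le> c' * c powr r"
      using assms(4) unfolding at_most_exponential_growth_def by metis
    \<comment> \<open>Makes \<open>c powr (\<epsilon> * r)\<close> at most
      \<open>q powr (r / 2)\<close>; the added \<open>1\<close> avoids a zero denominator when
      \<open>c = 1\<close>.\<close>
    define \<epsilon> where "\<epsilon> = ln q / (2 * (ln c + 1))"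
    have lnc: "0 \<le> ln c" "0 < ln q" using c(1) q by auto
    then have \<epsilon>: "0 < \<epsilon>" "\<epsilon> * ln c \<le> ln q / 2"
      by (auto simp: \<epsilon>_def field_simps)
    obtain N :: nat and \<Lambda> :: real where \<Lambda>: "\<Lambda> \<ge> 1"
      and comp: "\<And>r. r \<ge> \<Lambda> \<Longrightarrow> \<exists>h\<in>X \<rightarrow> X. (\<exists>C. \<forall>y\<in>X. \<rho> y (h y) \<le> C) \<and>
       (\<forall>x\<in>X. \<exists>T\<subseteq>X. finite T \<and> card T \<le> N \<and> (\<forall>y\<in>X. \<rho> x y \<le> r \<longrightarrow> (\<exists>t\<in>T. \<rho> t (h y) \<le> \<epsilon> * r)))"
      by (rule exists_compressing_map[OF assms(2) False \<epsilon>(1)]) (rule that)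
    have bound: "asdim_fun X \<rho> r \<le> ereal (N * (c' * exp (ln q / 2 * (r + 1))))" if r: "r \<ge> \<Lambda>" for r
    proof -
      have r': "r + 1 \<ge> \<Lambda>" "0 < \<epsilon> * (r + 1)" using r \<Lambda> \<epsilon>(1) by auto
      obtain h C where h: "h \<in> X \<rightarrow> X" "\<And>y. y \<in> X \<Longrightarrow> \<rho> y (h y) \<le> C"
        "\<And>x. x \<in> X \<Longrightarrow> \<exists>T\<subseteq>X. finite T \<and> card T \<le> N \<and> (\<forall>y\<in>X. \<rho> x y \<le> r + 1 \<longrightarrow> (\<exists>t\<in>T. \<rho> t (h y) \<le> \<epsilon> * (r + 1)))"
        using comp[OF r'(1)] by blast
      \<comment> \<open>At most \<open>N\<close> balls of radius \<open>\<epsilon> * (r + 1)\<close>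
        contain the image of a ball of radius \<open>r + 1\<close>; the floor makes this bound an
        integer.\<close>
      define n where "n = nat \<lfloor>N * (c' * c powr (\<epsilon> * (r + 1)))\<rfloor>"
      have "finite (h ` mcball x (r + 1)) \<and> card (h ` mcball x (r + 1)) \<le> n" if x: "x \<in> X" for x
      proof -
        obtain T where T: "T \<subseteq> X" "finite T" "card T \<le> N"
          "\<And>y. \<lbrakk>y \<in> X; \<rho> x y \<le> r + 1\<rbrakk> \<Longrightarrow> \<exists>t\<in>T. \<rho> t (h y) \<le> \<epsilon> * (r + 1)"
          using h(3)[OF x] by blast
        have sub: "h ` mcball x (r + 1) \<subseteq> (\<Union>t\<in>T. mcball t (\<epsilon> * (r + 1)))"
        proof
          fix z assume "z \<in> h ` mcball x (r + 1)"
          then obtain y where y: "y \<in> X" "\<rho> x y \<le> r + 1" "z = h y" by auto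
          then obtain t where "t \<in> T" "\<rho> t (h y) \<le> \<epsilon> * (r + 1)" using T(4) by blast
          then show "z \<in> (\<Union>t\<in>T. mcball t (\<epsilon> * (r + 1)))"
            using y h(1) T(1) by (intro UN_I[of t]) auto
        qed
        have fin: "finite (\<Union>t\<in>T. mcball t (\<epsilon> * (r + 1)))"
          using T(1,2) c(3) r'(2) by auto
        have "card (h ` mcball x (r + 1)) \<le> card (\<Union>t\<in>T. mcball t (\<epsilon> * (r + 1)))"
          by (rule card_mono[OF fin sub])
        also have "\<dots> \<le> (\<Sum>t\<in>T. card (mcball t (\<epsilon> * (r + 1))))"
          by (rule card_UN_le[OF T(2)])
        finally have "real (card (h ` mcball x (r + 1))) \<le> (\<Sum>t\<in>T. real (card (mcball t (\<epsilon> * (r + 1)))))"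
          by (metis of_nat_le_iff of_nat_sum)
        also have "\<dots> \<le> (\<Sum>t\<in>T. c' * c powr (\<epsilon> * (r + 1)))"
          using T(1) c(3) r'(2) by (intro sum_mono) blast
        also have "\<dots> = card T * (c' * c powr (\<epsilon> * (r + 1)))" by simp
        also have "\<dots> \<le> N * (c' * c powr (\<epsilon> * (r + 1)))"
          using T(3) c(2) by (intro mult_right_mono) auto
        finally have "card (h ` mcball x (r + 1)) \<le> n"
          unfolding n_def by linarith
        then show ?thesis using finite_subset[OF sub fin] by blast
      qed
      then have "asdim_fun X \<rho> r \<le> ereal (real n)"
        using r \<Lambda> by (intro asdim_fun_le[of r "r + 1" h C n] False h(1,2)) auto
      also have "real n \<le> N * (c' * c powr (\<epsilon> * (r + 1)))"
        unfolding n_def using c(2) by (intro of_nat_floor) simp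
      also have "\<dots> \<le> N * (c' * exp (ln q / 2 * (r + 1)))"
      proof -
        have "\<epsilon> * (r + 1) * ln c \<le> ln q / 2 * (r + 1)"
          using mult_right_mono[OF \<epsilon>(2), of "r + 1"] r \<Lambda> by (simp add: algebra_simps)
        then show ?thesis
          using c(1,2) by (intro mult_left_mono) (auto simp: powr_def)
      qed
      finally show ?thesis by simp
    qed
    have "\<forall>\<^sub>F r in at_top. N * (c' * exp (ln q / 2 * (r + 1))) \<le> q powr r"
    proof -
      have "\<forall>\<^sub>F r in at_top. r \<ge> 2 / ln q * (ln (N * c' + 1) + ln q / 2)"
        by (rule eventually_ge_at_top)
      then show ?thesis
      proof eventually_elim
        case (elim r)
        \<comment> \<open>The exponent grows at half the rate of \<open>q powr r\<close>, and the
          other half absorbs the constants; adding \<open>1\<close> keeps the argument of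
          \<open>ln\<close> positive even for \<open>N = 0\<close>.\<close>
        have pos: "0 < N * c' + 1" using c(2) by (simp add: add_nonneg_pos)
        have "ln (N * c' + 1) + ln q / 2 \<le> ln q / 2 * r"
          using elim lnc(2) by (simp add: field_simps)
        then have "ln (N * c' + 1) + ln q / 2 * (r + 1) \<le> ln q * r"
          by (simp add: field_simps)
        then have "exp (ln (N * c' + 1) + ln q / 2 * (r + 1)) \<le> exp (ln q * r)" by simp
        then have "(N * c' + 1) * exp (ln q / 2 * (r + 1)) \<le> q powr r"
          using pos q by (simp add: exp_add powr_def mult.commute)
        moreover have "N * (c' * exp (ln q / 2 * (r + 1))) \<le> (N * c' + 1) * exp (ln q / 2 * (r + 1))"
          by (simp add: algebra_simps)
        ultimately show ?case by linarith
      qed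
    qed
    moreover have "\<forall>\<^sub>F r in at_top. r \<ge> \<Lambda>" by (rule eventually_ge_at_top)
    ultimately show ?thesis
    proof eventually_elim
      case (elim r)
      then have "ereal (N * (c' * exp (ln q / 2 * (r + 1)))) \<le> ereal (q powr r)" by simp
      with bound[OF elim(2)] show ?case by (rule order_trans)
    qed
  qed
qed

end
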